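(* Let $\rho_{AB}$ be a state of a bipartite quantum system $AB$. Then $\rho_{AB}$ is locally broadcastable if and only if $\rho_{AB}$ is classical-classical.
   Context: All Hilbert spaces are finite-dimensional. A state on a system is a positive semidefinite operator of trace one on its Hilbert space; a bipartite state $\rho_{AB}$ is a state on $\mathcal{H}_A\otimes\mathcal{H}_B$. All maps are channels, i.e. linear, completely positive and trace preserving maps (the input and output systems may be different). A bipartite state $\rho$ is classical-classical (CC) if there exist an orthonormal set $\{|i\rangle\}$ in $\mathcal{H}_A$, an orthonormal set $\{|j\rangle\}$ in $\mathcal{H}_B$, and a joint probability distribution $\{p_{ij}\}$ such that $\rho=\sum_{ij}p_{ij}|i\rangle\langle i|\otimes|j\rangle\langle j|$. Let $A'$ be a copy of the system $A$ and $B'$ a copy of the system $B$ (so states on $A'B'$ are identified with states on $AB$). A state $\sigma_{AA'BB'}$ is a broadcast state for $\rho_{AB}$ if its reductions satisfy $\sigma_{AB}=\mathrm{Tr}_{A'B'}(\sigma_{AA'BB'})=\rho_{AB}$ and $\sigma_{A'B'}=\mathrm{Tr}_{AB}(\sigma_{AA'BB'})=\rho_{AB}$. The state $\rho_{AB}$ is locally broadcastable (LB) if there exist channels $\Theta_A:A\to AA'$ and $\Theta_B:B\to BB'$ such that $(\Theta_A\otimes\Theta_B)[\rho_{AB}]$ is a broadcast state for $\rho_{AB}$. *)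

theory Defs
  imports "HOL-Analysis.Analysis"
begin

text \<open>
  A finite-dimensional Hilbert space with a fixed orthonormal basis indexed by a finite
  type is \<open>complex ^ 'a\<close>; its tensor product with \<open>complex ^ 'b\<close> is \<open>complex ^ ('a \<times> 'b)\<close>,
  and operators are square matrices.
\<close>

type_synonym 'a operator = "complex ^ 'a ^ 'a"

text \<open>The inner product \<open>\<bullet>\<close> of the library is the real one, so the complex one is needed here.\<close>

definition cinner :: "complex ^ 'a::finite \<Rightarrow> complex ^ 'a \<Rightarrow> complex"
  where "cinner u v = (\<Sum>i\<in>UNIV. cnj (u $ i) * v $ i)"

definition orthonormal :: "(complex ^ 'a::finite) set \<Rightarrow> bool"
  where "orthonormal S \<longleftrightarrow> (\<forall>u\<in>S. \<forall>v\<in>S. cinner u v = (if u = v then 1 else 0))"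

text \<open>\<open>ketbra u v\<close> is the operator \<open>|u\<rangle>\<langle>v|\<close>.\<close>

definition ketbra :: "complex ^ 'a::finite \<Rightarrow> complex ^ 'a \<Rightarrow> 'a operator"
  where "ketbra u v = (\<chi> i j. u $ i * cnj (v $ j))"

definition tensor_op :: "'a::finite operator \<Rightarrow> 'b::finite operator \<Rightarrow> ('a \<times> 'b) operator"
  where "tensor_op X Y = (\<chi> p q. X $ fst p $ fst q * Y $ snd p $ snd q)"

text \<open>Over the complex numbers, a nonnegative real quadratic form forces the operator to be Hermitian.\<close>

definition psd :: "'a::finite operator \<Rightarrow> bool"
  where "psd X \<longleftrightarrow> (\<forall>v. cinner v (X *v v) \<in> \<real>\<^sub>\<ge>\<^sub>0)"

definition is_state :: "'a::finite operator \<Rightarrow> bool"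
  where "is_state X \<longleftrightarrow> psd X \<and> trace X = 1"

text \<open>The library's \<open>linear\<close> is linearity over the reals; complex linearity is
  \<open>Vector_Spaces.linear\<close> with respect to the following scaling.\<close>

definition scale_op :: "complex \<Rightarrow> 'a::finite operator \<Rightarrow> 'a operator"
  where "scale_op c X = map_matrix (\<lambda>x. c * x) X"

text \<open>
  Complete positivity asks that \<open>id\<^sub>n \<otimes> \<Phi>\<close> preserve positivity for every \<open>n\<close>.  An operator
  on \<open>\<complex>\<^sup>n \<otimes> H\<close> is given by its \<open>n \<times> n\<close> family of blocks, which are operators on \<open>H\<close>, and
  \<open>id\<^sub>n \<otimes> \<Phi>\<close> applies \<open>\<Phi>\<close> to each block.  Blocks with an index \<open>\<ge> n\<close> are irrelevant.
\<close>

definition block_psd :: "nat \<Rightarrow> (nat \<Rightarrow> nat \<Rightarrow> 'a::finite operator) \<Rightarrow> bool"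
  where "block_psd n X \<longleftrightarrow>
    (\<forall>v :: nat \<Rightarrow> complex ^ 'a. (\<Sum>i<n. \<Sum>j<n. cinner (v i) (X i j *v v j)) \<in> \<real>\<^sub>\<ge>\<^sub>0)"

definition completely_positive :: "('a::finite operator \<Rightarrow> 'b::finite operator) \<Rightarrow> bool"
  where "completely_positive \<Phi> \<longleftrightarrow>
    (\<forall>n X. block_psd n X \<longrightarrow> block_psd n (\<lambda>i j. \<Phi> (X i j)))"

definition trace_preserving :: "('a::finite operator \<Rightarrow> 'b::finite operator) \<Rightarrow> bool"
  where "trace_preserving \<Phi> \<longleftrightarrow> (\<forall>X. trace (\<Phi> X) = trace X)"

definition channel :: "('a::finite operator \<Rightarrow> 'b::finite operator) \<Rightarrow> bool"
  where "channel \<Phi> \<longleftrightarrow>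
    Vector_Spaces.linear scale_op scale_op \<Phi> \<and> completely_positive \<Phi> \<and> trace_preserving \<Phi>"

text \<open>
  The tensor product of linear maps is obtained by expanding the argument in the basis
  \<open>|i\<rangle>\<langle>j| \<otimes> |k\<rangle>\<langle>l|\<close>.  It is the linear map that sends \<open>X \<otimes> Y\<close> to \<open>\<Phi> X \<otimes> \<Psi> Y\<close>, see
  \<open>tensor_map_tensor_op\<close> and \<open>linear_tensor_map\<close> below.
\<close>

definition tensor_map ::
  "('a::finite operator \<Rightarrow> 'c::finite operator) \<Rightarrow> ('b::finite operator \<Rightarrow> 'd::finite operator)
    \<Rightarrow> ('a \<times> 'b) operator \<Rightarrow> ('c \<times> 'd) operator"
  where "tensor_map \<Phi> \<Psi> X =
    (\<Sum>i\<in>UNIV. \<Sum>j\<in>UNIV. \<Sum>k\<in>UNIV. \<Sum>l\<in>UNIV. scale_op (X $ (i, k) $ (j, l))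
      (tensor_op (\<Phi> (ketbra (axis i 1) (axis j 1))) (\<Psi> (ketbra (axis k 1) (axis l 1)))))"

definition classical_classical :: "('a::finite \<times> 'b::finite) operator \<Rightarrow> bool"
  where "classical_classical \<rho> \<longleftrightarrow>
    (\<exists>(E :: (complex ^ 'a) set) (F :: (complex ^ 'b) set)
       (p :: complex ^ 'a \<Rightarrow> complex ^ 'b \<Rightarrow> real).
      finite E \<and> orthonormal E \<and> finite F \<and> orthonormal F \<and>
      (\<forall>u\<in>E. \<forall>v\<in>F. 0 \<le> p u v) \<and> (\<Sum>u\<in>E. \<Sum>v\<in>F. p u v) = 1 \<and>
      \<rho> = (\<Sum>u\<in>E. \<Sum>v\<in>F. p u v *\<^sub>R tensor_op (ketbra u u) (ketbra v v)))"

text \<open>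
  The copies \<open>A'\<close> and \<open>B'\<close> have the same index types as \<open>A\<close> and \<open>B\<close>.  The four systems are
  ordered as \<open>(AA')(BB')\<close>, the output order of a product of maps \<open>A \<rightarrow> AA'\<close> and \<open>B \<rightarrow> BB'\<close>;
  the partial traces below are over \<open>A'B'\<close> and over \<open>AB\<close> respectively.
\<close>

definition reduction_AB ::
  "(('a::finite \<times> 'a) \<times> ('b::finite \<times> 'b)) operator \<Rightarrow> ('a \<times> 'b) operator"
  where "reduction_AB \<sigma> = (\<chi> p q. \<Sum>a'\<in>UNIV. \<Sum>b'\<in>UNIV.
    \<sigma> $ ((fst p, a'), (snd p, b')) $ ((fst q, a'), (snd q, b')))"

definition reduction_A'B' ::
  "(('a::finite \<times> 'a) \<times> ('b::finite \<times> 'b)) operator \<Rightarrow> ('a \<times> 'b) operator"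
  where "reduction_A'B' \<sigma> = (\<chi> p q. \<Sum>a\<in>UNIV. \<Sum>b\<in>UNIV.
    \<sigma> $ ((a, fst p), (b, snd p)) $ ((a, fst q), (b, snd q)))"

definition broadcast_state ::
  "(('a::finite \<times> 'a) \<times> ('b::finite \<times> 'b)) operator \<Rightarrow> ('a \<times> 'b) operator \<Rightarrow> bool"
  where "broadcast_state \<sigma> \<rho> \<longleftrightarrow>
    is_state \<sigma> \<and> reduction_AB \<sigma> = \<rho> \<and> reduction_A'B' \<sigma> = \<rho>"

definition locally_broadcastable :: "('a::finite \<times> 'b::finite) operator \<Rightarrow> bool"
  where "locally_broadcastable \<rho> \<longleftrightarrow>
    (\<exists>(\<Theta>A :: 'a operator \<Rightarrow> ('a \<times> 'a) operator) (\<Theta>B :: 'b operator \<Rightarrow> ('b \<times> 'b) operator).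
      channel \<Theta>A \<and> channel \<Theta>B \<and> broadcast_state (tensor_map \<Theta>A \<Theta>B \<rho>) \<rho>)"

lemma scale_op_nth [simp]: "scale_op c X $ i $ j = c * X $ i $ j"
  by (simp add: scale_op_def)

lemma tensor_op_nth [simp]: "tensor_op X Y $ p $ q = X $ fst p $ fst q * Y $ snd p $ snd q"
  by (simp add: tensor_op_def)

lemma vector_space_scale_op: "vector_space (scale_op :: complex \<Rightarrow> 'a::finite operator \<Rightarrow> _)"
  by unfold_locales (simp_all add: vec_eq_iff algebra_simps)

lemma operator_basis_expansion:
  fixes X :: "'a::finite operator"
  shows "X = (\<Sum>i\<in>UNIV. \<Sum>j\<in>UNIV. scale_op (X $ i $ j) (ketbra (axis i 1) (axis j 1)))"
proof -
  have "(\<Sum>i\<in>UNIV. \<Sum>j\<in>UNIV. X $ i $ j * (axis i 1 $ a * cnj (axis j 1 $ b))) = X $ a $ b" for a b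
  proof -
    have "(\<Sum>j\<in>UNIV. X $ i $ j * (axis i 1 $ a * cnj (axis j 1 $ b)))
        = (if i = a then X $ i $ b else 0)" for i
      by (simp add: axis_def if_distrib [of cnj] mult_delta_right cong: if_cong)
    then show ?thesis
      by simp
  qed
  then show ?thesis
    by (simp add: vec_eq_iff ketbra_def)
qed

lemma tensor_map_tensor_op:
  fixes \<Phi> :: "'a::finite operator \<Rightarrow> 'b::finite operator"
    and \<Psi> :: "'c::finite operator \<Rightarrow> 'd::finite operator"
  assumes "Vector_Spaces.linear scale_op scale_op \<Phi>" "Vector_Spaces.linear scale_op scale_op \<Psi>"
  shows "tensor_map \<Phi> \<Psi> (tensor_op X Y) = tensor_op (\<Phi> X) (\<Psi> Y)"
proof -
  have expand: "\<Theta> Z = (\<Sum>i\<in>UNIV. \<Sum>j\<in>UNIV. scale_op (Z $ i $ j) (\<Theta> (ketbra (axis i 1) (axis j 1))))"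
    if "Vector_Spaces.linear scale_op scale_op \<Theta>"
    for \<Theta> :: "'x::finite operator \<Rightarrow> 'y::finite operator" and Z
  proof -
    interpret Vector_Spaces.linear scale_op scale_op \<Theta> by (fact that)
    show ?thesis
      by (subst operator_basis_expansion) (simp add: sum scale)
  qed
  have reorder: "(\<Sum>k\<in>UNIV. \<Sum>i\<in>UNIV. \<Sum>l\<in>UNIV. \<Sum>j\<in>UNIV. f i j k l)
      = (\<Sum>i\<in>UNIV. \<Sum>j\<in>UNIV. \<Sum>k\<in>UNIV. \<Sum>l\<in>UNIV. f i j k l)"
    for f :: "'a \<Rightarrow> 'a \<Rightarrow> 'c \<Rightarrow> 'c \<Rightarrow> complex"
  proof -
    have "(\<Sum>k\<in>UNIV. \<Sum>i\<in>UNIV. \<Sum>l\<in>UNIV. \<Sum>j\<in>UNIV. f i j k l)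
        = (\<Sum>i\<in>UNIV. \<Sum>k\<in>UNIV. \<Sum>l\<in>UNIV. \<Sum>j\<in>UNIV. f i j k l)"
      by (rule sum.swap)
    also have "\<dots> = (\<Sum>i\<in>UNIV. \<Sum>k\<in>UNIV. \<Sum>j\<in>UNIV. \<Sum>l\<in>UNIV. f i j k l)"
      by (intro sum.cong refl sum.swap)
    also have "\<dots> = (\<Sum>i\<in>UNIV. \<Sum>j\<in>UNIV. \<Sum>k\<in>UNIV. \<Sum>l\<in>UNIV. f i j k l)"
      by (intro sum.cong refl sum.swap)
    finally show ?thesis .
  qed
  have "tensor_op (\<Phi> X) (\<Psi> Y) $ p $ q = tensor_map \<Phi> \<Psi> (tensor_op X Y) $ p $ q" for p q
    by (subst expand [OF assms(1)], subst expand [OF assms(2)])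
      (simp add: tensor_map_def sum_distrib_left sum_distrib_right mult_ac reorder)
  then show ?thesis
    by (simp add: vec_eq_iff)
qed

lemma linear_tensor_map:
  fixes \<Phi> :: "'a::finite operator \<Rightarrow> 'b::finite operator"
    and \<Psi> :: "'c::finite operator \<Rightarrow> 'd::finite operator"
  shows "Vector_Spaces.linear scale_op scale_op (tensor_map \<Phi> \<Psi>)"
  by (unfold Vector_Spaces.linear_iff, intro conjI vector_space_scale_op allI)
    (simp_all add: vec_eq_iff tensor_map_def sum.distrib sum_distrib_left algebra_simps)

end

theory Submission
  imports Defs
begin

text \<open>
  In the Heisenberg picture a channel \<open>\<Theta>\<^sub>A : A \<rightarrow> AA'\<close> is a positive unital bilinear map
  \<open>\<alpha> P Q = \<Theta>\<^sub>A\<^sup>*(P \<otimes> Q)\<close>, and likewise \<open>\<beta>\<close> for \<open>\<Theta>\<^sub>B\<close>.  That \<open>\<rho>\<close> is broadcast means that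
  the functional \<open>\<omega> X Y = trace ((X \<otimes> Y) \<rho>)\<close> is invariant under the pair of first marginals
  \<open>\<alpha> (\<cdot>) 1\<close>, \<open>\<beta> (\<cdot>) 1\<close> and under the pair of second marginals.  A recurrence argument along the
  powers of the marginals replaces \<open>\<alpha>\<close> by a map, of the same kind, both of whose marginals leave
  \<open>\<omega>\<close> invariant on their own; they then fix all expectations in the operators
  \<open>X = Tr\<^sub>B ((1 \<otimes> Y) \<rho>)\<close> of \<open>A\<close> that are steered from \<open>B\<close>.

  The projection onto the positive part of a steered operator maximises an expectation, so both
  marginals fix it (on the support of \<open>\<rho>\<^sub>A\<close>).  Hence any two of these projections are jointly
  measurable, and sharp jointly measurable effects commute.  In a common eigenbasis of the positive
  parts of all \<open>X - t \<rho>\<^sub>A\<close>, every steered operator is \<open>\<rho>\<^sub>A\<close> times a diagonal one, so the steered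
  operators commute.  The same holds for \<open>B\<close>, and the product of the two common eigenbases of
  steered operators diagonalises \<open>\<rho>\<close>.

  Conversely, a classical-classical state is broadcast by measuring in its eigenbases and preparing
  two copies of the outcome.
\<close>

subsection \<open>Hermitian and positive operators\<close>

definition adj :: "complex ^ 'a ^ 'b \<Rightarrow> complex ^ 'b ^ 'a"
  where "adj X = (\<chi> i j. cnj (X $ j $ i))"

definition hermitian :: "'a::finite operator \<Rightarrow> bool"
  where "hermitian X \<longleftrightarrow> adj X = X"

lemma cinner_add_left: "cinner (u + v) w = cinner u w + cinner v w"
  by (simp add: cinner_def algebra_simps sum.distrib)

lemma cinner_add_right: "cinner w (u + v) = cinner w u + cinner w v"
  by (simp add: cinner_def algebra_simps sum.distrib)

lemma cinner_diff_right: "cinner w (u - v) = cinner w u - cinner w v"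
  by (simp add: cinner_def algebra_simps sum_subtractf)

lemma cinner_scale_left: "cinner (c *s u) w = cnj c * cinner u w"
  by (simp add: cinner_def sum_distrib_left algebra_simps)

lemma cinner_scale_right: "cinner w (c *s u) = c * cinner w u"
  by (simp add: cinner_def sum_distrib_left algebra_simps)

lemma cinner_sum_right: "cinner w (sum f A) = (\<Sum>x\<in>A. cinner w (f x))"
  by (simp add: cinner_def sum_distrib_left sum.swap [of _ A])

lemma cinner_zero [simp]: "cinner 0 w = 0" "cinner w 0 = 0"
  by (simp_all add: cinner_def)

lemma cnj_cinner: "cnj (cinner u v) = cinner v u"
  by (simp add: cinner_def mult.commute)

lemma inner_eq_Re_cinner: "u \<bullet> v = Re (cinner u v)" for u v :: "complex ^ 'a::finite"
  by (simp add: cinner_def inner_vec_def inner_complex_def)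

lemma cinner_self: "cinner u u = of_real ((norm u)\<^sup>2)"
proof -
  have "cnj (cinner u u) = cinner u u"
    by (rule cnj_cinner)
  then have "Im (cinner u u) = 0"
    by (simp add: complex_eq_iff)
  then show ?thesis
    by (simp add: complex_eq_iff power2_norm_eq_inner inner_eq_Re_cinner)
qed

lemma cinner_self_eq_0 [simp]: "cinner u u = 0 \<longleftrightarrow> u = 0"
  by (simp add: cinner_self)

lemma cinner_axis: "cinner (axis i 1) v = v $ i"
  by (simp add: cinner_def axis_def if_distrib [of cnj] mult_delta_left cong: if_cong)

lemma cinner_adj: "cinner (adj X *v u) v = cinner u (X *v v)"
proof -
  have "cinner (adj X *v u) v = (\<Sum>i\<in>UNIV. \<Sum>j\<in>UNIV. X $ j $ i * cnj (u $ j) * v $ i)"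
    by (simp add: cinner_def matrix_vector_mult_def adj_def sum_distrib_right)
  also have "\<dots> = (\<Sum>j\<in>UNIV. \<Sum>i\<in>UNIV. X $ j $ i * cnj (u $ j) * v $ i)"
    by (rule sum.swap)
  also have "\<dots> = cinner u (X *v v)"
    by (simp add: cinner_def matrix_vector_mult_def sum_distrib_left mult_ac)
  finally show ?thesis .
qed

lemma matrix_vector_mult_cscale: "X *v (c *s v) = c *s (X *v v)" for X :: "'a::finite operator"
  by (simp add: vec_eq_iff matrix_vector_mult_def sum_distrib_left mult_ac)

lemma matrix_vector_scaleR:
  "X *v (r *\<^sub>R v) = r *\<^sub>R (X *v v)" "(r *\<^sub>R X) *v v = r *\<^sub>R (X *v v)"
  for X :: "'a::finite operator"
  by (simp_all add: vec_eq_iff matrix_vector_mult_def scaleR_sum_right)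

lemma matrix_mult_scaleR:
  "X ** (r *\<^sub>R Y) = r *\<^sub>R (X ** Y)" "(r *\<^sub>R X) ** Y = r *\<^sub>R (X ** Y)"
  for X Y :: "'a::finite operator"
  by (simp_all add: vec_eq_iff matrix_matrix_mult_def scaleR_sum_right)

lemma operator_eqI: "X = Y" if "\<And>u v. cinner u (X *v v) = cinner u (Y *v v)" for X Y :: "'a::finite operator"
proof -
  have "cinner (X *v v - Y *v v) (X *v v - Y *v v) = 0" for v
    using that by (simp add: cinner_diff_right)
  then show ?thesis
    by (simp add: matrix_eq)
qed

lemma adj_mult: "adj (X ** Y) = adj Y ** adj X"
  by (simp add: adj_def matrix_matrix_mult_def vec_eq_iff mult.commute)

lemma adj_adj [simp]: "adj (adj X) = X"
  by (simp add: adj_def vec_eq_iff)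

lemma adj_simps [simp]:
  "adj (X + Y) = adj X + adj Y" "adj (X - Y) = adj X - adj Y" "adj (r *\<^sub>R X) = r *\<^sub>R adj X"
  by (simp_all add: adj_def vec_eq_iff)

lemma adj_mat1 [simp]: "adj (mat 1 :: 'a::finite operator) = mat 1"
  by (simp add: adj_def mat_def vec_eq_iff)

lemma adj_zero [simp]: "adj 0 = 0"
  by (simp add: adj_def vec_eq_iff)

lemma adj_sum: "adj (sum f A) = (\<Sum>x\<in>A. adj (f x))"
  by (induction A rule: infinite_finite_induct) simp_all

lemma hermitian_simps:
  "hermitian X \<Longrightarrow> hermitian Y \<Longrightarrow> hermitian (X + Y)"
  "hermitian X \<Longrightarrow> hermitian Y \<Longrightarrow> hermitian (X - Y)"
  "hermitian X \<Longrightarrow> hermitian (r *\<^sub>R X)"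
  "hermitian (mat 1 :: 'a::finite operator)"
  "hermitian (0 :: 'a::finite operator)"
  by (simp_all add: hermitian_def)

lemma hermitian_cinner: "cinner (X *v u) v = cinner u (X *v v)" if "hermitian X"
  using cinner_adj [of X u v] that by (simp add: hermitian_def)

lemma hermitian_inner: "(X *v u) \<bullet> v = u \<bullet> (X *v v)" if "hermitian X"
  using hermitian_cinner [OF that] by (simp add: inner_eq_Re_cinner)

text \<open>The quadratic form of \<open>adj X - X\<close> vanishes because that of \<open>X\<close>
  is real; polarization with \<open>u + v\<close> and \<open>u + \<i> *s v\<close> then kills the
  whole sesquilinear form.\<close>

lemma psd_hermitian: "hermitian X" if "psd X" for X :: "'a::finite operator"
proof -
  define D where "D = adj X - X"
  have D0: "cinner v (D *v v) = 0" for v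
  proof -
    have "cnj (cinner v (X *v v)) = cinner v (X *v v)"
      using \<open>psd X\<close> by (simp add: psd_def complex_eq_iff complex_nonneg_Reals_iff)
    then have "cinner v (adj X *v v) = cinner v (X *v v)"
      by (metis cinner_adj cnj_cinner)
    then show ?thesis
      by (simp add: D_def matrix_vector_mult_diff_rdistrib cinner_diff_right)
  qed
  have "cinner u (D *v v) = 0" for u v
  proof -
    have 1: "cinner u (D *v v) + cinner v (D *v u) = 0"
      using D0 [of "u + v"] D0 [of u] D0 [of v]
      by (simp add: matrix_vector_right_distrib cinner_add_left cinner_add_right add.commute)
    have "\<i> * cinner u (D *v v) - \<i> * cinner v (D *v u) = 0"
      using D0 [of "u + \<i> *s v"] D0 [of u] D0 [of v]
      by (simp add: matrix_vector_right_distrib cinner_add_left cinner_add_right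
          matrix_vector_mult_cscale cinner_scale_left cinner_scale_right)
    then have "cinner u (D *v v) = cinner v (D *v u)"
      by simp
    with 1 show ?thesis
      by (metis mult_2 mult_eq_0_iff zero_neq_numeral)
  qed
  then have "D = 0"
    by (intro operator_eqI) simp
  then show ?thesis
    by (simp add: D_def hermitian_def)
qed

text \<open>For a Hermitian operator the form has no imaginary part, so positivity can be handled
  through the real inner product and the order of the reals.\<close>

lemma psd_iff: "psd X \<longleftrightarrow> hermitian X \<and> (\<forall>v. 0 \<le> v \<bullet> (X *v v))" for X :: "'a::finite operator"
proof -
  have "Im (cinner v (X *v v)) = 0" if "hermitian X" for v
  proof -
    have "cnj (cinner v (X *v v)) = cinner v (X *v v)"
      using that by (metis cnj_cinner hermitian_cinner)
    then show ?thesis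
      by (simp add: complex_eq_iff)
  qed
  then show ?thesis
    using psd_hermitian
    by (auto simp: psd_def complex_nonneg_Reals_iff inner_eq_Re_cinner)
qed

lemma psdI: "hermitian X \<Longrightarrow> (\<And>v. 0 \<le> v \<bullet> (X *v v)) \<Longrightarrow> psd X"
  by (simp add: psd_iff)

lemma psd_inner: "psd X \<Longrightarrow> 0 \<le> v \<bullet> (X *v v)"
  by (simp add: psd_iff)

lemma psd_add: "psd X \<Longrightarrow> psd Y \<Longrightarrow> psd (X + Y)"
  by (simp add: psd_iff hermitian_simps matrix_vector_mult_add_rdistrib inner_add_right)

lemma psd_scaleR: "psd X \<Longrightarrow> 0 \<le> r \<Longrightarrow> psd (r *\<^sub>R X)"
  by (simp add: psd_iff hermitian_simps matrix_vector_scaleR)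

lemma psd_zero: "psd 0"
  by (simp add: psd_iff hermitian_simps)

lemma psd_mat1: "psd (mat 1)"
  by (simp add: psd_iff hermitian_simps)

lemma psd_sum: "(\<And>x. x \<in> A \<Longrightarrow> psd (f x)) \<Longrightarrow> psd (sum f A)"
  by (induction A rule: infinite_finite_induct) (simp_all add: psd_zero psd_add)

lemma psd_conj: "psd (adj S ** X ** S)" if "psd X"
proof (rule psdI)
  show "hermitian (adj S ** X ** S)"
    using psd_hermitian [OF that] by (simp add: hermitian_def adj_mult matrix_mul_assoc [symmetric])
  fix v
  have "v \<bullet> ((adj S ** X ** S) *v v) = (S *v v) \<bullet> (X *v (S *v v))"
    by (metis adj_adj cinner_adj inner_eq_Re_cinner matrix_vector_mul_assoc)
  then show "0 \<le> v \<bullet> ((adj S ** X ** S) *v v)"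
    using that by (simp add: psd_iff)
qed

text \<open>A parabola through the origin that never goes below zero has slope zero there.\<close>

lemma quadratic_nonneg_linear_coeff:
  fixes a b :: real
  assumes "\<And>t. 0 \<le> 2 * t * a + t\<^sup>2 * b"
  shows "a = 0"
proof -
  \<comment> \<open>A positive upper bound of \<open>b\<close>: at \<open>t = - a / c\<close> the
    quadratic is at most \<open>- a\<^sup>2 / c\<close>.\<close>
  define c where "c = \<bar>b\<bar> + 1"
  have "(- a / c)\<^sup>2 * b \<le> (- a / c)\<^sup>2 * c"
    by (intro mult_left_mono) (auto simp: c_def)
  also have "\<dots> = a\<^sup>2 / c"
    by (simp add: c_def power2_eq_square)
  finally have "0 \<le> - a\<^sup>2 / c"
    using assms [of "- a / c"] by (simp add: power2_eq_square)
  moreover have "0 < c"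
    by (simp add: c_def)
  ultimately show ?thesis
    by (simp add: divide_le_0_iff)
qed

text \<open>\<open>v\<close> minimises the form, so its derivative vanishes in every direction; in
  the direction \<open>X *v v\<close> that derivative is twice the squared length of
  \<open>X *v v\<close>.\<close>

lemma psd_kernel: "X *v v = 0" if "psd X" "v \<bullet> (X *v v) = 0"
proof -
  let ?w = "X *v v"
  have h: "hermitian X"
    using that(1) by (rule psd_hermitian)
  have pos: "0 \<le> (v + t *\<^sub>R ?w) \<bullet> (X *v (v + t *\<^sub>R ?w))" for t
    using that(1) by (rule psd_inner)
  have "0 \<le> 2 * t * (?w \<bullet> ?w) + t\<^sup>2 * (?w \<bullet> (X *v ?w))" for t
  proof -
    have "v \<bullet> (X *v ?w) = ?w \<bullet> ?w"
      using h by (simp add: hermitian_inner)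
    then show ?thesis
      using pos [of t] that(2)
      by (simp add: matrix_vector_right_distrib inner_add_left inner_add_right power2_eq_square
          matrix_vector_scaleR distrib_left)
  qed
  then have "?w \<bullet> ?w = 0"
    by (rule quadratic_nonneg_linear_coeff)
  then show ?thesis
    by simp
qed

subsection \<open>Orthonormal bases and the spectral theorem\<close>

lemma ketbra_mult_vec: "ketbra u v *v w = cinner v w *s u"
  by (simp add: vec_eq_iff ketbra_def matrix_vector_mult_def cinner_def sum_distrib_left mult_ac)

lemma adj_ketbra: "adj (ketbra u v) = ketbra v u"
  by (simp add: vec_eq_iff ketbra_def adj_def mult.commute)

lemma cinner_ketbra: "cinner w (ketbra u v *v z) = cinner w u * cinner v z"
  by (simp add: ketbra_mult_vec cinner_scale_right mult.commute)

lemma psd_ketbra: "psd (ketbra u u)"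
proof (rule psdI)
  show "hermitian (ketbra u u)"
    by (simp add: hermitian_def adj_ketbra)
  show "0 \<le> v \<bullet> (ketbra u u *v v)" for v
  proof -
    have "cinner v (ketbra u u *v v) = cnj (cinner u v) * cinner u v"
      by (simp add: cinner_ketbra cnj_cinner)
    then show ?thesis
      by (simp add: inner_eq_Re_cinner)
  qed
qed

lemma trace_mult_ketbra: "trace (X ** ketbra u v) = cinner v (X *v u)"
proof -
  have "trace (X ** ketbra u v) = (\<Sum>i\<in>UNIV. (X *v u) $ i * cnj (v $ i))"
    by (simp add: trace_def matrix_matrix_mult_def matrix_vector_mult_def ketbra_def
        sum_distrib_left sum_distrib_right mult_ac)
  then show ?thesis
    by (simp add: cinner_def mult.commute)
qed

lemma trace_simps:
  "trace (X + Y) = trace X + trace Y" "trace (X - Y) = trace X - trace Y"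
  "trace (r *\<^sub>R X) = r *\<^sub>R trace X" "trace (0 :: complex ^ 'a ^ 'a) = 0"
  for X Y :: "complex ^ 'a::finite ^ 'a"
  by (simp_all add: trace_def sum.distrib sum_subtractf scaleR_sum_right)

lemma trace_sum: "trace (sum f A) = (\<Sum>x\<in>A. trace (f x))" for f :: "'b \<Rightarrow> complex ^ 'a::finite ^ 'a"
  by (induction A rule: infinite_finite_induct) (simp_all add: trace_simps)

lemma matrix_mult_sum_right: "X ** sum f A = (\<Sum>x\<in>A. X ** f x)" for X :: "complex ^ 'a::finite ^ 'a"
  by (induction A rule: infinite_finite_induct) (simp_all add: matrix_add_ldistrib)

lemma sum_matrix_vector_mult: "sum f A *v v = (\<Sum>x\<in>A. f x *v v)" for f :: "'b \<Rightarrow> complex ^ 'a::finite ^ 'a"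
  by (induction A rule: infinite_finite_induct) (simp_all add: matrix_vector_mult_add_rdistrib)

text \<open>Completeness is stated as a trivial orthogonal complement, which is exactly what holds
  once an orthonormal set cannot be extended.\<close>

definition onb :: "(complex ^ 'a::finite) set \<Rightarrow> bool"
  where "onb B \<longleftrightarrow> finite B \<and> orthonormal B \<and> (\<forall>w. (\<forall>u\<in>B. cinner u w = 0) \<longrightarrow> w = 0)"

lemma onb_sum_ketbra: "(\<Sum>u\<in>B. ketbra u u) = mat 1" if "onb B"
proof -
  have "(\<Sum>u\<in>B. cinner u w *s u) = w" for w
  proof -
    \<comment> \<open>The error of the expansion of \<open>w\<close> is orthogonal to the whole
      basis.\<close>
    have "cinner x (w - (\<Sum>u\<in>B. cinner u w *s u)) = 0" if "x \<in> B" for x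
    proof -
      have "cinner x (\<Sum>u\<in>B. cinner u w *s u) = (\<Sum>u\<in>B. if u = x then cinner x w else 0)"
        unfolding cinner_sum_right
        using \<open>onb B\<close> that by (intro sum.cong) (auto simp: onb_def orthonormal_def cinner_scale_right)
      also have "\<dots> = cinner x w"
        using \<open>onb B\<close> that by (simp add: onb_def)
      finally show ?thesis
        by (simp add: cinner_diff_right)
    qed
    then have "w - (\<Sum>u\<in>B. cinner u w *s u) = 0"
      using that unfolding onb_def by blast
    then show ?thesis
      by simp
  qed
  then show ?thesis
    by (simp add: matrix_eq sum_matrix_vector_mult ketbra_mult_vec)
qed

lemma onb_trace: "trace X = (\<Sum>u\<in>B. cinner u (X *v u))" if "onb B"
proof -
  have "trace X = trace (X ** (\<Sum>u\<in>B. ketbra u u))"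
    by (simp add: onb_sum_ketbra [OF that])
  then show ?thesis
    by (simp add: matrix_mult_sum_right trace_sum trace_mult_ketbra)
qed

lemma onb_vec_eqI: "v = w" if "onb B" "\<And>u. u \<in> B \<Longrightarrow> cinner u v = cinner u w"
proof -
  have "v - w = 0"
    using that by (metis (no_types, lifting) onb_def cinner_diff_right right_minus_eq)
  then show ?thesis
    by simp
qed

lemma onb_operator_eqI:
  fixes X Y :: "'a::finite operator"
  assumes "onb B" "\<And>u. u \<in> B \<Longrightarrow> X *v u = Y *v u"
  shows "X = Y"
proof -
  have "X *v w = Y *v w" for w
  proof -
    have "w = (\<Sum>u\<in>B. cinner u w *s u)"
      by (metis (no_types, lifting) assms(1) ketbra_mult_vec matrix_vector_mul_lid onb_sum_ketbra
          sum.cong sum_matrix_vector_mult)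
    moreover have "Z *v (\<Sum>u\<in>B. cinner u w *s u) = (\<Sum>u\<in>B. cinner u w *s (Z *v u))"
      for Z :: "'a operator"
    proof -
      have "Z *v sum f A = (\<Sum>x\<in>A. Z *v f x)" for f :: "complex ^ 'a \<Rightarrow> complex ^ 'a" and A
        by (induction A rule: infinite_finite_induct) (simp_all add: matrix_vector_right_distrib)
      then show ?thesis
        by (simp add: matrix_vector_mult_cscale)
    qed
    ultimately show ?thesis
      using assms(2) by (metis (no_types, lifting) sum.cong)
  qed
  then show ?thesis
    by (simp add: matrix_eq)
qed

text \<open>Complex orthonormality implies orthogonality for the real inner product, hence
  independence over the reals. The bound by the real dimension yields finiteness and a measure for
  extending orthonormal sets.\<close>

lemma orthonormal_card: "finite E \<and> card E \<le> DIM(complex ^ 'a)"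
  if "orthonormal E" for E :: "(complex ^ 'a::finite) set"
proof -
  have "0 \<notin> E"
    using that by (auto simp: orthonormal_def dest!: bspec [where x = 0])
  moreover have "pairwise orthogonal E"
    using that by (auto simp: orthonormal_def pairwise_def orthogonal_def inner_eq_Re_cinner)
  ultimately have "independent E"
    by (intro pairwise_orthogonal_independent)
  then show ?thesis
    using independent_bound by blast
qed

text \<open>One unit vector is added at a time until the orthogonal complement is trivial. With the
  invariant \<open>P\<close> the same induction serves to complete a basis (\<open>P\<close> always
  true) and to find a basis of common eigenvectors.\<close>

lemma orthonormal_extend:
  fixes E :: "(complex ^ 'a::finite) set"
  assumes "orthonormal E" "\<And>u. u \<in> E \<Longrightarrow> P u"
    and step: "\<And>E w. \<lbrakk>orthonormal E; \<And>u. u \<in> E \<Longrightarrow> P u; w \<noteq> 0; \<And>u. u \<in> E \<Longrightarrow> cinner u w = 0\<rbrakk>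
      \<Longrightarrow> \<exists>w. P w \<and> cinner w w = 1 \<and> (\<forall>u\<in>E. cinner u w = 0)"
  shows "\<exists>B. onb B \<and> E \<subseteq> B \<and> (\<forall>u\<in>B. P u)"
  using assms(1,2)
proof (induction "DIM(complex ^ 'a) - card E" arbitrary: E rule: less_induct)
  case less
  show ?case
  proof (cases "\<forall>w. (\<forall>u\<in>E. cinner u w = 0) \<longrightarrow> w = 0")
    case True
    then have "onb E"
      using less.prems orthonormal_card by (auto simp: onb_def)
    then show ?thesis
      using less.prems by blast
  next
    case False
    then obtain w where w: "P w" "cinner w w = 1" "\<forall>u\<in>E. cinner u w = 0"
      using step [OF less.prems(1,2)] by blast
    have w': "\<forall>u\<in>E. cinner w u = 0"
      using w(3) by (metis cnj_cinner complex_cnj_zero)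
    have o: "orthonormal (insert w E)"
      using less.prems(1) w w' by (auto simp: orthonormal_def)
    have "w \<notin> E"
      using w by auto
    then have "card (insert w E) = Suc (card E)"
      using orthonormal_card [OF less.prems(1)] by simp
    moreover have "card (insert w E) \<le> DIM(complex ^ 'a)"
      using o orthonormal_card by blast
    ultimately have "\<exists>B. onb B \<and> insert w E \<subseteq> B \<and> (\<forall>u\<in>B. P u)"
      using less.prems(2) w(1) o by (intro less.hyps) auto
    then show ?thesis
      by blast
  qed
qed

lemma exists_normalized: "\<exists>c::real. cinner (c *\<^sub>R w) (c *\<^sub>R w) = 1" if "w \<noteq> 0" for w :: "complex ^ 'a::finite"
  using that by (intro exI [of _ "inverse (norm w)"]) (simp add: cinner_self)

lemma cinner_scaleR_right: "cinner u (c *\<^sub>R w) = c *\<^sub>R cinner u w"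
  by (simp add: cinner_def scaleR_sum_right)

lemma orthonormal_extend_onb: "\<exists>B. onb B \<and> E \<subseteq> B" if "orthonormal E"
proof -
  have "\<exists>B. onb B \<and> E \<subseteq> B \<and> (\<forall>u\<in>B. True)"
  proof (rule orthonormal_extend [OF that])
    fix F :: "(complex ^ 'a) set" and w :: "complex ^ 'a"
    assume "w \<noteq> 0" and *: "\<And>u. u \<in> F \<Longrightarrow> cinner u w = 0"
    then obtain c :: real where "cinner (c *\<^sub>R w) (c *\<^sub>R w) = 1"
      using exists_normalized by blast
    with * show "\<exists>w. True \<and> cinner w w = 1 \<and> (\<forall>u\<in>F. cinner u w = 0)"
      by (intro exI [of _ "c *\<^sub>R w"]) (simp add: cinner_scaleR_right)
  qed simp
  then show ?thesis
    by blast
qed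

text \<open>The eigenvector maximises the Rayleigh quotient over the unit sphere of \<open>V\<close>: the positive
  operator \<open>\<lambda> - X\<close> on \<open>V\<close> vanishes in direction \<open>v\<close>, so \<open>v\<close> is in its kernel.\<close>

lemma hermitian_eigenvector:
  fixes X :: "'a::finite operator"
  assumes "hermitian X" "subspace V" "w \<in> V" "w \<noteq> 0" and inv: "\<And>v. v \<in> V \<Longrightarrow> X *v v \<in> V"
  shows "\<exists>l::real. \<exists>v\<in>V. v \<noteq> 0 \<and> X *v v = l *\<^sub>R v"
proof -
  let ?S = "V \<inter> sphere 0 1"
  have "compact ?S"
    using assms(2) by (intro closed_Int_compact closed_subspace compact_sphere)
  moreover have "inverse (norm w) *\<^sub>R w \<in> ?S"
    using assms by (simp add: subspace_scale)
  moreover have "bounded_linear (\<lambda>v. X *v v)"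
    by (intro linear_conv_bounded_linear [THEN iffD1] linearI)
      (simp_all add: matrix_vector_right_distrib matrix_vector_scaleR)
  then have "continuous_on ?S (\<lambda>v. v \<bullet> (X *v v))"
    by (intro continuous_on_inner continuous_on_id linear_continuous_on)
  ultimately have "\<exists>v\<in>?S. \<forall>u\<in>?S. u \<bullet> (X *v u) \<le> v \<bullet> (X *v v)"
    by (intro continuous_attains_sup) blast+
  then obtain v where v: "v \<in> ?S" and max: "\<And>u. u \<in> ?S \<Longrightarrow> u \<bullet> (X *v u) \<le> v \<bullet> (X *v v)"
    by blast
  define l where "l = v \<bullet> (X *v v)"
  define D where "D u = l *\<^sub>R u - X *v u" for u
  have D_lin: "D (u + t *\<^sub>R z) = D u + t *\<^sub>R D z" for u z t
    by (simp add: D_def matrix_vector_right_distrib matrix_vector_scaleR algebra_simps)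
  have D_sym: "u \<bullet> D z = D u \<bullet> z" for u z
    using assms(1) by (simp add: D_def inner_diff_left inner_diff_right hermitian_inner)
  have D_pos: "0 \<le> u \<bullet> D u" if "u \<in> V" for u
  proof (cases "u = 0")
    case False
    have "inverse (norm u) *\<^sub>R u \<in> ?S"
      using that False assms(2) by (simp add: subspace_scale)
    from max [OF this] have "inverse (norm u) * inverse (norm u) * (u \<bullet> (X *v u)) \<le> l"
      by (simp add: l_def matrix_vector_scaleR mult.assoc)
    then have "u \<bullet> (X *v u) \<le> l * (norm u * norm u)"
      using False by (simp add: field_simps)
    then show ?thesis
      by (simp add: D_def inner_diff_right power2_norm_eq_inner [symmetric] power2_eq_square)
  qed simp
  have "v \<bullet> v = 1"
    using v by (simp add: norm_eq_1)
  then have D0: "v \<bullet> D v = 0"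
    by (simp add: D_def inner_diff_right l_def)
  \<comment> \<open>Positivity of \<open>D\<close> is known on \<open>V\<close> only, so the
    perturbation argument of \<open>psd_kernel\<close> is repeated with a direction that stays in
    \<open>V\<close>.\<close>
  define z where "z = D v"
  have "z \<in> V"
    using v assms(2) inv by (auto simp: z_def D_def intro: subspace_diff subspace_scale)
  have "0 \<le> 2 * t * (z \<bullet> z) + t\<^sup>2 * (z \<bullet> D z)" for t
  proof -
    have "v + t *\<^sub>R z \<in> V"
      using v \<open>z \<in> V\<close> assms(2) by (simp add: subspace_add subspace_scale)
    from D_pos [OF this] show ?thesis
      using D0 D_sym [of v z]
      by (simp add: D_lin inner_add_left inner_add_right power2_eq_square distrib_left z_def [symmetric])
  qed
  then have "z \<bullet> z = 0"
    by (rule quadratic_nonneg_linear_coeff)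
  then have "X *v v = l *\<^sub>R v"
    by (simp add: z_def D_def)
  moreover have "v \<in> V" "v \<noteq> 0"
    using v by auto
  ultimately show ?thesis
    by blast
qed

text \<open>In the complement of the eigenvectors found so far, take a nonzero invariant subspace
  \<open>V\<close> of least dimension. Each \<open>X\<close> has an eigenvector in \<open>V\<close>,
  and its eigenspace inside \<open>V\<close> is again invariant because the family commutes; by
  minimality it is all of \<open>V\<close>. Every member is thus scalar on \<open>V\<close>, also
  when the family is infinite.\<close>

lemma commuting_common_eigenbasis:
  fixes \<F> :: "'a::finite operator set"
  assumes herm: "\<And>X. X \<in> \<F> \<Longrightarrow> hermitian X"
    and comm: "\<And>X Y. \<lbrakk>X \<in> \<F>; Y \<in> \<F>\<rbrakk> \<Longrightarrow> X ** Y = Y ** X"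
  shows "\<exists>B. onb B \<and> (\<forall>X\<in>\<F>. \<forall>u\<in>B. \<exists>r::real. X *v u = r *\<^sub>R u)"
proof -
  let ?P = "\<lambda>u. \<forall>X\<in>\<F>. \<exists>r::real. X *v u = r *\<^sub>R u"
  have "\<exists>B. onb B \<and> {} \<subseteq> B \<and> (\<forall>u\<in>B. ?P u)"
  proof (rule orthonormal_extend)
    fix E :: "(complex ^ 'a) set" and w :: "complex ^ 'a"
    assume E: "\<And>u. u \<in> E \<Longrightarrow> ?P u" and w: "w \<noteq> 0" "\<And>u. u \<in> E \<Longrightarrow> cinner u w = 0"
    define inv where "inv V \<longleftrightarrow> subspace V \<and> (\<exists>v\<in>V. v \<noteq> 0) \<and> (\<forall>X\<in>\<F>. \<forall>v\<in>V. X *v v \<in> V)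
      \<and> (\<forall>v\<in>V. \<forall>u\<in>E. cinner u v = 0)" for V
    have "inv {v. \<forall>u\<in>E. cinner u v = 0}"
    proof -
      have "cinner u (X *v v) = 0" if X: "X \<in> \<F>" and u: "u \<in> E" and v: "\<forall>u\<in>E. cinner u v = 0" for X u v
      proof -
        obtain r :: real where "X *v u = r *\<^sub>R u"
          using E [OF u] X by blast
        then have "cinner (X *v u) v = r *\<^sub>R cinner u v"
          by (simp add: cinner_def scaleR_sum_right)
        then show ?thesis
          using herm [OF X] u v by (simp add: hermitian_cinner)
      qed
      then show ?thesis
        using w unfolding inv_def subspace_def
        by (auto simp: cinner_add_right cinner_scaleR_right intro!: exI [of _ w])
    qed
    then obtain V where V: "inv V" and min: "\<And>W. inv W \<Longrightarrow> dim V \<le> dim W"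
      using ex_has_least_nat [of inv] by blast
    have scalar: "\<exists>r::real. \<forall>v\<in>V. X *v v = r *\<^sub>R v" if "X \<in> \<F>" for X
    proof -
      have "\<exists>r::real. \<exists>v\<in>V. v \<noteq> 0 \<and> X *v v = r *\<^sub>R v"
        using V that unfolding inv_def by (blast intro: hermitian_eigenvector [OF herm])
      then obtain r :: real and v where v: "v \<in> V" "v \<noteq> 0" "X *v v = r *\<^sub>R v"
        by blast
      let ?W = "{v \<in> V. X *v v = r *\<^sub>R v}"
      have "X *v (Y *v z) = r *\<^sub>R (Y *v z)" if "Y \<in> \<F>" "X *v z = r *\<^sub>R z" for Y z
        by (metis that comm \<open>X \<in> \<F>\<close> matrix_vector_mul_assoc matrix_vector_scaleR(1))
      then have "inv ?W"
        using V v
        by (auto simp: inv_def subspace_def matrix_vector_right_distrib matrix_vector_scaleR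
            scaleR_add_right mult.commute)
      then have "?W = V"
        using V min [of ?W] by (intro subspace_dim_equal) (auto simp: inv_def)
      then show ?thesis
        by blast
    qed
    obtain v where v: "v \<in> V" "v \<noteq> 0"
      using V by (auto simp: inv_def)
    obtain c :: real where c: "cinner (c *\<^sub>R v) (c *\<^sub>R v) = 1"
      using exists_normalized [OF v(2)] by blast
    have "c *\<^sub>R v \<in> V"
      using V v by (simp add: inv_def subspace_scale)
    then show "\<exists>w. ?P w \<and> cinner w w = 1 \<and> (\<forall>u\<in>E. cinner u w = 0)"
      using c scalar V unfolding inv_def by blast
  qed (simp_all add: orthonormal_def)
  then show ?thesis
    by blast
qed

lemma hermitian_spectral:
  fixes X :: "'a::finite operator"
  assumes "hermitian X"
  obtains B and l :: "complex ^ 'a \<Rightarrow> real"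
  where "onb B" "\<And>u. u \<in> B \<Longrightarrow> X *v u = l u *\<^sub>R u"
proof -
  obtain B where "onb B" "\<forall>u\<in>B. \<exists>r::real. X *v u = r *\<^sub>R u"
    using commuting_common_eigenbasis [of "{X}"] assms by auto
  then show ?thesis
    using that by metis
qed

section \<open>Functional calculus and traces of products of positive operators\<close>

lemma onb_functional:
  fixes l :: "complex ^ 'a::finite \<Rightarrow> real"
  assumes "onb B"
  defines "X \<equiv> (\<Sum>u\<in>B. l u *\<^sub>R ketbra u u)"
  shows "\<And>u. u \<in> B \<Longrightarrow> X *v u = l u *\<^sub>R u" and "hermitian X"
    and "(\<And>u. u \<in> B \<Longrightarrow> 0 \<le> l u) \<Longrightarrow> psd X"
proof -
  fix w assume "w \<in> B"
  have "X *v w = (\<Sum>u\<in>B. if u = w then l w *\<^sub>R w else 0)"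
    using assms(1) \<open>w \<in> B\<close> unfolding X_def sum_matrix_vector_mult
    by (intro sum.cong) (auto simp: matrix_vector_scaleR ketbra_mult_vec onb_def orthonormal_def)
  then show "X *v w = l w *\<^sub>R w"
    using assms \<open>w \<in> B\<close> by (simp add: onb_def)
next
  show "hermitian X"
    by (simp add: X_def hermitian_def adj_sum adj_ketbra)
  show "psd X" if "\<And>u. u \<in> B \<Longrightarrow> 0 \<le> l u"
    unfolding X_def using that by (intro psd_sum psd_scaleR psd_ketbra)
qed

lemma onb_diag_eq:
  fixes X :: "'a::finite operator"
  assumes "onb B" "\<And>u. u \<in> B \<Longrightarrow> X *v u = l u *\<^sub>R u"
  shows "X = (\<Sum>u\<in>B. l u *\<^sub>R ketbra u u)"
  using assms by (intro onb_operator_eqI [OF assms(1)]) (simp add: onb_functional(1))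

lemma psd_spectral:
  fixes X :: "'a::finite operator"
  assumes "psd X"
  obtains B and l :: "complex ^ 'a \<Rightarrow> real"
  where "onb B" "\<And>u. u \<in> B \<Longrightarrow> X *v u = l u *\<^sub>R u" "\<And>u. u \<in> B \<Longrightarrow> 0 \<le> l u"
proof -
  obtain B and l :: "complex ^ 'a \<Rightarrow> real"
    where B: "onb B" and l: "\<And>u. u \<in> B \<Longrightarrow> X *v u = l u *\<^sub>R u"
    using hermitian_spectral psd_hermitian [OF assms] by blast
  have "0 \<le> l u" if "u \<in> B" for u
  proof -
    have "u \<bullet> u = 1"
      using B that by (simp add: onb_def orthonormal_def inner_eq_Re_cinner)
    then show ?thesis
      using psd_inner [OF assms, of u] l [OF that] by simp
  qed
  with B l that show thesis
    by blast
qed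

text \<open>In an eigenbasis of \<open>Y\<close> the trace is a sum of nonnegative terms
  \<open>l u * (u \<bullet> (X *v u))\<close>. If it vanishes, so does every term, and then
  \<open>l u = 0\<close> or, by \<open>psd_kernel\<close>, \<open>X *v u = 0\<close>.\<close>

lemma trace_psd_mult:
  assumes "psd X" "psd Y"
  shows "trace (X ** Y) \<in> \<real>\<^sub>\<ge>\<^sub>0" and "trace (X ** Y) = 0 \<Longrightarrow> X ** Y = 0"
proof -
  obtain B and l :: "complex ^ 'a \<Rightarrow> real" where B: "onb B"
    and l: "\<And>u. u \<in> B \<Longrightarrow> Y *v u = l u *\<^sub>R u" and l0: "\<And>u. u \<in> B \<Longrightarrow> 0 \<le> l u"
    using psd_spectral [OF assms(2)] by blast
  have "trace (X ** Y) = (\<Sum>u\<in>B. l u *\<^sub>R cinner u (X *v u))"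
    unfolding onb_trace [OF B]
    by (intro sum.cong refl)
      (simp add: l matrix_vector_mul_assoc [symmetric] matrix_vector_scaleR cinner_scaleR_right)
  also have "\<dots> = (\<Sum>u\<in>B. of_real (l u * (u \<bullet> (X *v u))))"
    using assms(1)
    by (intro sum.cong refl)
      (auto simp: psd_def complex_nonneg_Reals_iff complex_eq_iff inner_eq_Re_cinner)
  finally have tr: "trace (X ** Y) = of_real (\<Sum>u\<in>B. l u * (u \<bullet> (X *v u)))"
    by simp
  have pos: "0 \<le> l u * (u \<bullet> (X *v u))" if "u \<in> B" for u
    using l0 [OF that] psd_inner [OF assms(1)] by simp
  show "trace (X ** Y) \<in> \<real>\<^sub>\<ge>\<^sub>0"
    unfolding tr using pos by (simp add: complex_nonneg_Reals_iff sum_nonneg)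
  show "X ** Y = 0" if "trace (X ** Y) = 0"
  proof -
    have "(\<Sum>u\<in>B. l u * (u \<bullet> (X *v u))) = 0"
      using that by (metis tr of_real_eq_0_iff)
    then have *: "l u * (u \<bullet> (X *v u)) = 0" if "u \<in> B" for u
      using pos that B by (subst (asm) sum_nonneg_eq_0_iff) (auto simp: onb_def)
    show ?thesis
    proof (rule onb_operator_eqI [OF B])
      fix u assume "u \<in> B"
      then have "l u = 0 \<or> X *v u = 0"
        using * psd_kernel [OF assms(1), of u] by auto
      then show "(X ** Y) *v u = 0 *v u"
        by (auto simp: matrix_vector_mul_assoc [symmetric] l [OF \<open>u \<in> B\<close>] matrix_vector_scaleR)
    qed
  qed
qed

subsection \<open>Joint measurability and commutation\<close>

text \<open>\<open>P\<close> is the spectral projection of \<open>Z\<close> for the strictly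
  positive eigenvalues; \<open>Z ** P\<close> and \<open>Z ** P - Z\<close> are the positive and the
  negative part of \<open>Z\<close>. The factor \<open>W\<close> records that \<open>P\<close>
  vanishes on the kernel of \<open>Z\<close>.\<close>

definition is_pos_proj :: "'a::finite operator \<Rightarrow> 'a operator \<Rightarrow> bool"
  where "is_pos_proj Z P \<longleftrightarrow> hermitian P \<and> P ** P = P \<and> P ** Z = Z ** P \<and>
    psd (Z ** P) \<and> psd (Z ** P - Z) \<and> (\<exists>W. P = W ** Z \<and> P = Z ** W)"

lemma exists_pos_proj: "\<exists>P. is_pos_proj Z P" if "hermitian Z" for Z :: "'a::finite operator"
proof -
  from that obtain B and l :: "complex ^ 'a \<Rightarrow> real"
    where B: "onb B" and l: "\<And>u. u \<in> B \<Longrightarrow> Z *v u = l u *\<^sub>R u"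
    using hermitian_spectral by blast
  define fn where "fn f = (\<Sum>u\<in>B. f (l u) *\<^sub>R ketbra u u)" for f :: "real \<Rightarrow> real"
  \<comment> \<open>\<open>W\<close> inverts the positive eigenvalues and is 0 elsewhere, so
    \<open>W ** Z\<close> is 1 exactly where \<open>Z\<close> is strictly positive.\<close>
  define P W where "P = fn (\<lambda>x. if 0 < x then 1 else 0)" and "W = fn (\<lambda>x. if 0 < x then inverse x else 0)"
  have fn: "fn f *v u = f (l u) *\<^sub>R u" if "u \<in> B" for f u
    unfolding fn_def by (rule onb_functional(1) [OF B that])
  note apply_simps = matrix_vector_mul_assoc [symmetric] matrix_vector_mult_diff_rdistrib
    matrix_vector_scaleR fn l P_def W_def
  have "Z ** P = fn (\<lambda>x. max x 0)" "Z ** P - Z = fn (\<lambda>x. max (- x) 0)"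
    by (rule onb_operator_eqI [OF B]; simp add: apply_simps max_def)+
  moreover have "psd (fn (\<lambda>x. max x 0))" "psd (fn (\<lambda>x. max (- x) 0))"
    unfolding fn_def by (rule onb_functional(3) [OF B]; simp)+
  moreover have "hermitian P"
    unfolding P_def fn_def by (rule onb_functional(2) [OF B])
  moreover have "P ** P = P" "P ** Z = Z ** P" "P = W ** Z" "P = Z ** W"
    by (rule onb_operator_eqI [OF B]; simp add: apply_simps)+
  ultimately show ?thesis
    unfolding is_pos_proj_def by (intro exI [of _ P]) metis
qed

lemma matrix_mult_diff:
  "X ** (Y - Z) = X ** Y - X ** Z" "(Y - Z) ** X = Y ** X - Z ** X" for X Y Z :: "'a::finite operator"
  by (simp_all add: vec_eq_iff matrix_matrix_mult_def algebra_simps sum_subtractf)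

lemma psd_proj: "psd P" "psd (mat 1 - P)" if "hermitian P" "P ** P = P"
proof -
  have "P = adj P ** mat 1 ** P"
    using that by (simp add: hermitian_def)
  then show "psd P"
    using psd_conj [OF psd_mat1, of P] by simp
  have "mat 1 - P = adj (mat 1 - P) ** mat 1 ** (mat 1 - P)"
    using that by (simp add: hermitian_def matrix_mult_diff)
  then show "psd (mat 1 - P)"
    using psd_conj [OF psd_mat1, of "mat 1 - P"] by simp
qed

text \<open>On the range of \<open>E\<close> the form of \<open>X\<close> is squeezed between 0 and
  that of \<open>C\<close>, which vanishes there.\<close>

lemma psd_dominated_mult_0: "X ** E = 0" if "psd X" "psd (C - X)" "C ** E = 0" for X :: "'a::finite operator"
proof -
  have "X *v (E *v v) = 0" for v
  proof (rule psd_kernel [OF that(1)])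
    let ?w = "E *v v"
    have "C *v ?w = 0"
      using that(3) by (simp add: matrix_vector_mul_assoc)
    then have "?w \<bullet> (X *v ?w) \<le> 0"
      using psd_inner [OF that(2), of ?w]
      by (simp add: matrix_vector_mult_diff_rdistrib inner_diff_right)
    then show "?w \<bullet> (X *v ?w) = 0"
      using psd_inner [OF that(1), of ?w] by simp
  qed
  then show ?thesis
    by (simp add: matrix_eq matrix_vector_mul_assoc [symmetric])
qed

text \<open>Among the effects \<open>0 \<le> G \<le> 1\<close>, the maximum of \<open>trace (G ** Z)\<close> determines \<open>G\<close> up to a
  part supported in the kernel of \<open>Z\<close>; that part vanishes on the support of \<open>\<rho>\<close>.\<close>

lemma pos_proj_unique_maximizer:
  fixes G :: "'a::finite operator"
  assumes "psd \<rho>" "is_pos_proj \<rho> S" "is_pos_proj Z P" "hermitian Z" "Z ** S = Z"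
    and G: "psd G" "psd (mat 1 - G)"
    and trZ: "trace (G ** Z) = trace (P ** Z)" and trR: "trace (G ** \<rho>) = trace (P ** \<rho>)"
  shows "S ** G ** S = P"
proof -
  have P: "P ** P = P" "P ** Z = Z ** P" "psd (Z ** P)" "psd (Z ** P - Z)"
    and herm: "adj P = P" "adj S = S" "adj G = G"
    using \<open>is_pos_proj Z P\<close> \<open>is_pos_proj \<rho> S\<close> psd_hermitian [OF G(1)]
    by (simp_all add: is_pos_proj_def hermitian_def)
  obtain W where W: "P = W ** Z" "P = Z ** W"
    using \<open>is_pos_proj Z P\<close> unfolding is_pos_proj_def by blast
  obtain V where V: "S = \<rho> ** V"
    using \<open>is_pos_proj \<rho> S\<close> unfolding is_pos_proj_def by blast
  \<comment> \<open>The amount by which \<open>G\<close> falls short of the maximum splits into two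
    nonnegative terms: the positive part of \<open>Z\<close> that \<open>G\<close> misses and the
    negative part that it catches.\<close>
  have "trace ((mat 1 - G) ** (Z ** P)) + trace (G ** (Z ** P - Z)) = 0"
    by (simp add: matrix_mult_diff trace_simps trZ P(2))
  moreover have "trace ((mat 1 - G) ** (Z ** P)) \<in> \<real>\<^sub>\<ge>\<^sub>0"
    by (rule trace_psd_mult(1) [OF G(2) P(3)])
  moreover have "trace (G ** (Z ** P - Z)) \<in> \<real>\<^sub>\<ge>\<^sub>0"
    by (rule trace_psd_mult(1) [OF G(1) P(4)])
  ultimately have "trace ((mat 1 - G) ** (Z ** P)) = 0"
    by (auto simp: complex_nonneg_Reals_iff complex_eq_iff)
  then have "(mat 1 - G) ** (Z ** P) = 0"
    by (rule trace_psd_mult(2) [OF G(2) P(3)])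
  \<comment> \<open>\<open>W\<close> cancels \<open>Z\<close> on the range of
    \<open>P\<close>.\<close>
  moreover have "(mat 1 - G) ** P = (mat 1 - G) ** (Z ** P) ** W"
  proof -
    have "P = Z ** P ** W"
      using P(1,2) W(2) by (metis matrix_mul_assoc)
    then show ?thesis
      by (metis matrix_mul_assoc)
  qed
  ultimately have "(mat 1 - G) ** P = 0"
    by simp
  then have GP: "G ** P = P"
    by (simp add: matrix_mult_diff)
  then have PG: "P ** G = P"
    by (metis adj_mult herm(1,3))
  \<comment> \<open>\<open>G\<close> is the identity on the range of \<open>P\<close>, so what is
    left of it is its compression to the complement, which is positive.\<close>
  have "G - P = adj (mat 1 - P) ** G ** (mat 1 - P)"
    by (simp add: matrix_mult_diff herm GP PG P(1))
  then have "psd (G - P)"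
    using psd_conj [OF G(1), of "mat 1 - P"] by simp
  moreover have "trace ((G - P) ** \<rho>) = 0"
    by (simp add: matrix_mult_diff trace_simps trR)
  ultimately have "(G - P) ** \<rho> = 0"
    using \<open>psd \<rho>\<close> by (intro trace_psd_mult(2))
  then have "(G - P) ** S = 0"
    by (simp add: V matrix_mul_assoc)
  then have "G ** S = P ** S"
    by (simp add: matrix_mult_diff)
  moreover have PS: "P ** S = P"
    using W(1) \<open>Z ** S = Z\<close> by (metis matrix_mul_assoc)
  moreover have "S ** P = P"
    using PS by (metis adj_mult herm(1,2))
  ultimately show ?thesis
    by (simp add: matrix_mul_assoc [symmetric])
qed

text \<open>For projections \<open>P\<close> and \<open>Q\<close>, the values of
  \<open>\<beta>\<close> at \<open>P\<close>, \<open>Q\<close> and their complements form a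
  measurement with four outcomes whose marginals are \<open>\<beta> P (mat 1)\<close> and
  \<open>\<beta> (mat 1) Q\<close>. As \<open>bilinear\<close> is over the reals, complex linearity
  is added as compatibility with \<open>\<i>\<close>.\<close>

definition joint :: "('a::finite operator \<Rightarrow> 'a operator \<Rightarrow> 'a operator) \<Rightarrow> bool"
  where "joint \<beta> \<longleftrightarrow> bilinear \<beta> \<and>
    (\<forall>X Y. \<beta> (scale_op \<i> X) Y = scale_op \<i> (\<beta> X Y) \<and> \<beta> X (scale_op \<i> Y) = scale_op \<i> (\<beta> X Y)) \<and>
    (\<forall>P Q. psd P \<longrightarrow> psd Q \<longrightarrow> psd (\<beta> P Q)) \<and> \<beta> (mat 1) (mat 1) = mat 1"

text \<open>Compressed by \<open>S\<close>, the effect \<open>\<beta> P Q\<close> lies below \<open>Q\<close> and \<open>\<beta> P (1 - Q)\<close> lies below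
  \<open>S - Q\<close>; as the two add up to \<open>P\<close>, the first one is \<open>P ** Q\<close>, which is therefore Hermitian.\<close>

lemma joint_projections_commute:
  fixes P Q S :: "'a::finite operator"
  assumes "joint \<beta>" and P: "hermitian P" "P ** P = P" and Q: "hermitian Q" "Q ** Q = Q"
    and S: "hermitian S" "S ** S = S" "S ** Q = Q"
    and bP: "S ** \<beta> P (mat 1) ** S = P" and bQ: "S ** \<beta> (mat 1) Q ** S = Q"
  shows "P ** Q = Q ** P"
proof -
  have bil: "bilinear \<beta>" and pos: "\<And>P Q. psd P \<Longrightarrow> psd Q \<Longrightarrow> psd (\<beta> P Q)"
    and one: "\<beta> (mat 1) (mat 1) = mat 1"
    using \<open>joint \<beta>\<close> by (auto simp: joint_def)
  define N where "N X Y = S ** \<beta> X Y ** S" for X Y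
  have N_psd: "psd (N X Y)" if "psd X" "psd Y" for X Y
    using psd_conj [OF pos [OF that], of S] S by (simp add: N_def hermitian_def)
  have NPQ: "psd (N P Q)" and NPQ': "psd (N P (mat 1 - Q))"
    and D: "psd (N (mat 1 - P) Q)" "psd (N (mat 1 - P) (mat 1 - Q))"
    using psd_proj [OF P] psd_proj [OF Q] by (auto intro!: N_psd)
  have N_diff: "N (mat 1 - P) Y = N (mat 1) Y - N P Y" "N X (mat 1 - Q) = N X (mat 1) - N X Q" for X Y
    by (simp_all add: N_def bilinear_lsub [OF bil] bilinear_rsub [OF bil] matrix_mult_diff)
  have N1: "N P (mat 1) = P" "N (mat 1) Q = Q" "N (mat 1) (mat 1) = S"
    using bP bQ S by (simp_all add: N_def one)
  have "N P Q ** (mat 1 - Q) = 0"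
  proof (rule psd_dominated_mult_0 [OF NPQ])
    show "psd (Q - N P Q)"
      using D(1) by (simp add: N_diff N1)
    show "Q ** (mat 1 - Q) = 0"
      using Q by (simp add: matrix_mult_diff)
  qed
  moreover have "N P (mat 1 - Q) ** Q = 0"
  proof (rule psd_dominated_mult_0 [OF NPQ'])
    show "psd (S - Q - N P (mat 1 - Q))"
      using D(2) by (simp add: N_diff N1 algebra_simps)
    show "(S - Q) ** Q = 0"
      using Q S by (simp add: matrix_mult_diff)
  qed
  ultimately have "N P Q = P ** Q"
    by (simp add: matrix_mult_diff N_diff N1)
  then show ?thesis
    using psd_hermitian [OF NPQ] P Q by (metis adj_mult hermitian_def)
qed

text \<open>Here \<open>R\<close> stands for the steered operators and \<open>\<rho>\<close> for the
  reduced state; \<open>tr1\<close> and \<open>tr2\<close> say that each marginal of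
  \<open>\<beta>\<close> preserves all expectations in \<open>R\<close>. Closure of \<open>R\<close>
  under real combinations matters: the positive parts of all \<open>X - t *\<^sub>R \<rho>\<close>
  are used.\<close>

lemma joint_commute:
  fixes R :: "'a::finite operator set"
  assumes joint: "joint \<beta>" and R: "subspace R" "\<And>X. X \<in> R \<Longrightarrow> hermitian X"
    and \<rho>: "\<rho> \<in> R" "psd \<rho>" and supp: "\<And>X v. \<lbrakk>X \<in> R; \<rho> *v v = 0\<rbrakk> \<Longrightarrow> X *v v = 0"
    and tr1: "\<And>X Z. X \<in> R \<Longrightarrow> trace (\<beta> Z (mat 1) ** X) = trace (Z ** X)"
    and tr2: "\<And>X Z. X \<in> R \<Longrightarrow> trace (\<beta> (mat 1) Z ** X) = trace (Z ** X)"
    and "X \<in> R" "Y \<in> R"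
  shows "X ** Y = Y ** X"
proof -
  obtain p where p: "\<And>Z. Z \<in> R \<Longrightarrow> is_pos_proj Z (p Z)"
    using exists_pos_proj R(2) by metis
  define S where "S = p \<rho>"
  have S: "is_pos_proj \<rho> S"
    using p \<rho>(1) by (simp add: S_def)
  \<comment> \<open>\<open>S\<close> is the support projection of \<open>\<rho>\<close>: on the
    range of \<open>mat 1 - S\<close> the form of \<open>\<rho>\<close> is nonpositive by
    \<open>is_pos_proj\<close>, hence zero, and \<open>supp\<close> carries this over to
    \<open>Z\<close>.\<close>
  have ZS: "Z ** S = Z" if "Z \<in> R" for Z
  proof -
    have "Z *v ((mat 1 - S) *v v) = 0" for v
    proof (rule supp [OF that], rule psd_kernel [OF \<rho>(2)])
      let ?w = "(mat 1 - S) *v v"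
      have "S *v ?w = 0"
        using S by (simp add: is_pos_proj_def matrix_vector_mul_assoc matrix_mult_diff)
      then have "(\<rho> ** S - \<rho>) *v ?w = - (\<rho> *v ?w)"
        by (simp add: matrix_vector_mult_diff_rdistrib matrix_vector_mul_assoc [symmetric])
      moreover have "0 \<le> ?w \<bullet> ((\<rho> ** S - \<rho>) *v ?w)"
        using S by (intro psd_inner) (simp add: is_pos_proj_def)
      ultimately show "?w \<bullet> (\<rho> *v ?w) = 0"
        using psd_inner [OF \<rho>(2), of ?w] by simp
    qed
    then have "Z ** (mat 1 - S) = 0"
      by (simp add: matrix_eq matrix_vector_mul_assoc [symmetric])
    then show ?thesis
      by (simp add: matrix_mult_diff)
  qed
  have bil: "bilinear \<beta>" and pos: "\<And>P Q. psd P \<Longrightarrow> psd Q \<Longrightarrow> psd (\<beta> P Q)"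
    and one: "\<beta> (mat 1) (mat 1) = mat 1"
    using joint by (auto simp: joint_def)
  \<comment> \<open>\<open>\<beta> (p Z) (mat 1)\<close> is an effect with the same expectations in
    \<open>Z\<close> and in \<open>\<rho>\<close> as \<open>p Z\<close>, so on the support of
    \<open>\<rho>\<close> it is the unique maximiser \<open>p Z\<close>; the second marginal is
    treated alike.\<close>
  have comm: "p Z ** p Z' = p Z' ** p Z" if Z: "Z \<in> R" and Z': "Z' \<in> R" for Z Z'
  proof (rule joint_projections_commute [OF joint, where S = S])
    have hp: "hermitian (p Z)" "p Z ** p Z = p Z" if "Z \<in> R" for Z
      using p [OF that] by (simp_all add: is_pos_proj_def)
    show "hermitian (p Z)" "p Z ** p Z = p Z" "hermitian (p Z')" "p Z' ** p Z' = p Z'"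
      using hp that by auto
    show hS: "hermitian S" "S ** S = S"
      using S by (auto simp: is_pos_proj_def)
    obtain W where "p Z' = W ** Z'"
      using p [OF Z'] by (auto simp: is_pos_proj_def)
    then have "p Z' ** S = p Z'"
      using ZS [OF Z'] by (metis matrix_mul_assoc)
    then show "S ** p Z' = p Z'"
      by (metis adj_mult hermitian_def hp(1) Z' hS(1))
    show "S ** \<beta> (p Z) (mat 1) ** S = p Z"
    proof (rule pos_proj_unique_maximizer [OF \<rho>(2) S p [OF Z] R(2) [OF Z] ZS [OF Z]])
      show "psd (\<beta> (p Z) (mat 1))"
        by (intro pos psd_proj hp Z psd_mat1)
      have "mat 1 - \<beta> (p Z) (mat 1) = \<beta> (mat 1 - p Z) (mat 1)"
        by (simp add: bilinear_lsub [OF bil] one)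
      also have "psd \<dots>"
        by (intro pos psd_proj hp Z psd_mat1)
      finally show "psd (mat 1 - \<beta> (p Z) (mat 1))" .
    qed (auto intro: tr1 Z \<rho>)
    show "S ** \<beta> (mat 1) (p Z') ** S = p Z'"
    proof (rule pos_proj_unique_maximizer [OF \<rho>(2) S p [OF Z'] R(2) [OF Z'] ZS [OF Z']])
      show "psd (\<beta> (mat 1) (p Z'))"
        by (intro pos psd_proj hp Z' psd_mat1)
      have "mat 1 - \<beta> (mat 1) (p Z') = \<beta> (mat 1) (mat 1 - p Z')"
        by (simp add: bilinear_rsub [OF bil] one)
      also have "psd \<dots>"
        by (intro pos psd_proj hp Z' psd_mat1)
      finally show "psd (mat 1 - \<beta> (mat 1) (p Z'))" .
    qed (auto intro: tr2 Z' \<rho>)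
  qed
  have "\<exists>B. onb B \<and> (\<forall>P\<in>p ` R. \<forall>u\<in>B. \<exists>r::real. P *v u = r *\<^sub>R u)"
    using p comm by (intro commuting_common_eigenbasis) (auto simp: is_pos_proj_def)
  then obtain B where B: "onb B" and eig: "\<And>Z u. \<lbrakk>Z \<in> R; u \<in> B\<rbrakk> \<Longrightarrow> \<exists>r::real. p Z *v u = r *\<^sub>R u"
    by blast
  \<comment> \<open>A common eigenvector has eigenvalue 0 or 1 under \<open>p Z\<close>, so it sees
    only the positive or only the negative part of \<open>Z\<close>. Either part is semidefinite,
    and a vanishing expectation puts \<open>u\<close> into its kernel.\<close>
  have ker: "Z *v u = 0" if Z: "Z \<in> R" and u: "u \<in> B" and "u \<bullet> (Z *v u) = 0" for Z u
  proof -
    obtain r :: real where r: "p Z *v u = r *\<^sub>R u"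
      using eig [OF Z u] by blast
    have pZ: "p Z ** p Z = p Z" "psd (Z ** p Z)" "psd (Z ** p Z - Z)"
      using p [OF Z] by (simp_all add: is_pos_proj_def)
    have "u \<noteq> 0"
      using B u by (auto simp: onb_def orthonormal_def dest!: bspec [where x = 0])
    have "p Z *v (p Z *v u) = p Z *v u"
      by (simp add: matrix_vector_mul_assoc pZ(1))
    then have "(r * r) *\<^sub>R u = r *\<^sub>R u"
      by (simp add: r matrix_vector_scaleR)
    then consider "r = 1" | "r = 0"
      using \<open>u \<noteq> 0\<close> by auto
    then show ?thesis
    proof cases
      case 1
      then have ZP: "(Z ** p Z) *v u = Z *v u"
        by (simp add: matrix_vector_mul_assoc [symmetric] r)
      have "(Z ** p Z) *v u = 0"
        by (rule psd_kernel [OF pZ(2)]) (simp add: ZP that(3))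
      then show ?thesis
        by (simp add: ZP)
    next
      case 2
      then have ZP: "(Z ** p Z - Z) *v u = - (Z *v u)"
        by (simp add: matrix_vector_mul_assoc [symmetric] r matrix_vector_mult_diff_rdistrib)
      have "(Z ** p Z - Z) *v u = 0"
        by (rule psd_kernel [OF pZ(3)]) (simp add: ZP that(3))
      then show ?thesis
        by (simp add: ZP)
    qed
  qed
  have ratio: "\<exists>t. \<forall>u\<in>B. X *v u = t u *\<^sub>R (\<rho> *v u)" if X: "X \<in> R" for X
  proof -
    have "\<exists>t. X *v u = t *\<^sub>R (\<rho> *v u)" if u: "u \<in> B" for u
    proof (cases "u \<bullet> (\<rho> *v u) = 0")
      case True
      then have "X *v u = 0"
        by (intro supp [OF X] psd_kernel [OF \<rho>(2)])
      then show ?thesis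
        by (intro exI [of _ 0]) simp
    next
      case False
      \<comment> \<open>This \<open>t\<close> makes the expectation of
        \<open>X - t *\<^sub>R \<rho>\<close> at \<open>u\<close> vanish, so that \<open>ker\<close>
        applies.\<close>
      define t where "t = (u \<bullet> (X *v u)) / (u \<bullet> (\<rho> *v u))"
      have "(X - t *\<^sub>R \<rho>) *v u = 0"
      proof (rule ker [OF _ u])
        show "X - t *\<^sub>R \<rho> \<in> R"
          using R(1) X \<rho>(1) by (simp add: subspace_diff subspace_scale)
        show "u \<bullet> ((X - t *\<^sub>R \<rho>) *v u) = 0"
          using False
          by (simp add: t_def matrix_vector_mult_diff_rdistrib matrix_vector_scaleR inner_diff_right)
      qed
      then show ?thesis
        by (auto simp: matrix_vector_mult_diff_rdistrib matrix_vector_scaleR)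
    qed
    then show ?thesis
      by metis
  qed
  define K where "K t = (\<Sum>u\<in>B. t u *\<^sub>R ketbra u u)" for t :: "complex ^ 'a \<Rightarrow> real"
  have K: "K t *v u = t u *\<^sub>R u" if "u \<in> B" for t u
    unfolding K_def by (rule onb_functional(1) [OF B that])
  \<comment> \<open>The first factorization is read off the basis \<open>B\<close>; the second is
    its adjoint, all three operators being Hermitian.\<close>
  have factor: "\<exists>t. X = \<rho> ** K t \<and> X = K t ** \<rho>" if X: "X \<in> R" for X
  proof -
    obtain t where t: "\<forall>u\<in>B. X *v u = t u *\<^sub>R (\<rho> *v u)"
      using ratio [OF X] by blast
    have X': "X = \<rho> ** K t"
      using t by (intro onb_operator_eqI [OF B])
        (simp add: matrix_vector_mul_assoc [symmetric] K matrix_vector_scaleR)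
    moreover have "adj X = X" "adj \<rho> = \<rho>" "adj (K t) = K t"
      using R(2) X \<rho>(1) onb_functional(2) [OF B] by (auto simp: hermitian_def K_def)
    ultimately show ?thesis
      by (metis adj_mult)
  qed
  obtain s t where s: "X = \<rho> ** K s" "X = K s ** \<rho>" and t: "Y = \<rho> ** K t" "Y = K t ** \<rho>"
    using factor \<open>X \<in> R\<close> \<open>Y \<in> R\<close> by metis
  have KK: "K s ** K t = K t ** K s"
    by (rule onb_operator_eqI [OF B]) (simp add: matrix_vector_mul_assoc [symmetric] K matrix_vector_scaleR)
  \<comment> \<open>With \<open>\<rho>\<close> on the outside on both sides, only the diagonal
    factors have to be exchanged.\<close>
  have "X ** Y = \<rho> ** (K s ** K t) ** \<rho>"
    by (metis s(1) t(2) matrix_mul_assoc)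
  also have "\<dots> = Y ** X"
    by (metis KK s(2) t(1) matrix_mul_assoc)
  finally show ?thesis .
qed

subsection \<open>Recurrence\<close>

text \<open>The bounded linear maps between two Euclidean spaces form a finite-dimensional space, so
  a norm-bounded sequence has a convergent subsequence.\<close>

lemma blinfun_convergent_subseq:
  fixes f :: "nat \<Rightarrow> 'x::euclidean_space \<Rightarrow> 'y::euclidean_space"
  assumes lin: "\<And>n. linear (f n)" and bnd: "\<And>n x. norm (f n x) \<le> C * norm x"
  obtains r :: "nat \<Rightarrow> nat" and F where "strict_mono r" "(\<lambda>n. Blinfun (f (r n))) \<longlonglongrightarrow> F"
proof -
  have "norm (Blinfun (f n)) \<le> \<bar>C\<bar>" for n
  proof (rule norm_blinfun_bound)
    have "bounded_linear (f n)"
      using lin by (simp add: linear_conv_bounded_linear)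
    then show "norm (blinfun_apply (Blinfun (f n)) x) \<le> \<bar>C\<bar> * norm x" for x
      using order_trans [OF bnd [of n x] mult_right_mono [OF abs_ge_self norm_ge_zero]]
      by (simp add: bounded_linear_Blinfun_apply)
  qed simp
  then have "bounded (range (\<lambda>n. Blinfun (f n)))"
    by (auto simp: bounded_iff)
  from bounded_imp_convergent_subsequence [OF this] that show thesis
    by (auto simp: o_def)
qed

lemma linear_funpow: "linear (f ^^ n)" if "linear f" for f :: "'a::real_vector \<Rightarrow> 'a"
proof (induction n)
  case 0
  show ?case
    by (rule linearI) simp_all
next
  case (Suc n)
  show ?case
    unfolding funpow.simps using Suc that by (rule linear_compose)
qed

text \<open>Along a subsequence \<open>s\<close> on which the powers of \<open>\<phi>\<close> and \<open>\<psi>\<close> converge, the powers of \<open>\<phi>\<close>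
  with exponent \<open>s (k + 1) - s k\<close> tend to a map that is absorbed by the limit of the powers of \<open>\<phi>\<close>.\<close>

lemma recurrence:
  fixes \<phi> :: "'x::euclidean_space \<Rightarrow> 'x" and \<psi> :: "'y::euclidean_space \<Rightarrow> 'y"
    and \<omega> :: "'x \<Rightarrow> 'y \<Rightarrow> 'z::real_normed_vector"
  assumes lin: "linear \<phi>" "linear \<psi>"
    and bnd: "\<And>n x. norm ((\<phi> ^^ n) x) \<le> C * norm x" "\<And>n y. norm ((\<psi> ^^ n) y) \<le> D * norm y"
    and \<omega>: "bounded_bilinear \<omega>" "\<And>x y. \<omega> (\<phi> x) (\<psi> y) = \<omega> x y"
  obtains r :: "nat \<Rightarrow> nat" and E where "\<And>x. (\<lambda>k. (\<phi> ^^ r k) x) \<longlonglongrightarrow> E x" "\<And>x y. \<omega> (\<phi> (E x)) y = \<omega> x y"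
proof -
  have B_apply: "blinfun_apply (Blinfun (\<phi> ^^ n)) = \<phi> ^^ n" "blinfun_apply (Blinfun (\<psi> ^^ n)) = \<psi> ^^ n" for n
    using lin [THEN linear_funpow]
    by (simp_all add: bounded_linear_Blinfun_apply linear_conv_bounded_linear)
  obtain s1 F where s1: "strict_mono s1" and F1: "(\<lambda>n. Blinfun (\<phi> ^^ s1 n)) \<longlonglongrightarrow> F"
    by (rule blinfun_convergent_subseq [OF linear_funpow [OF lin(1)] bnd(1)])
  obtain s2 G where s2: "strict_mono s2" and G2: "(\<lambda>n. Blinfun (\<psi> ^^ s1 (s2 n))) \<longlonglongrightarrow> G"
    by (rule blinfun_convergent_subseq [of "\<lambda>n. \<psi> ^^ s1 n" D, OF linear_funpow [OF lin(2)] bnd(2)])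
  define s where "s n = s1 (s2 n)" for n
  have s: "strict_mono s"
    using s1 s2 by (simp add: strict_mono_def s_def)
  have F: "(\<lambda>n. Blinfun (\<phi> ^^ s n)) \<longlonglongrightarrow> F" and G: "(\<lambda>n. Blinfun (\<psi> ^^ s n)) \<longlonglongrightarrow> G"
    using LIMSEQ_subseq_LIMSEQ [OF F1 s2] G2 by (simp_all add: s_def o_def)
  \<comment> \<open>One application of \<open>\<phi>\<close> is split off from the exponent
    \<open>s (Suc n) - s n\<close>, which is positive, since the conclusion speaks of
    \<open>\<phi> (E x)\<close> with \<open>E\<close> a limit of powers.\<close>
  define m where "m n = s (Suc n) - s n - 1" for n
  have sm: "s (Suc n) = s n + Suc (m n)" for n
    using strict_monoD [OF s, of n "Suc n"] by (simp add: m_def)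
  obtain r E where r: "strict_mono r" and E: "(\<lambda>n. Blinfun (\<phi> ^^ m (r n))) \<longlonglongrightarrow> E"
    by (rule blinfun_convergent_subseq [of "\<lambda>n. \<phi> ^^ m n" C, OF linear_funpow [OF lin(1)] bnd(1)])
  have E': "(\<lambda>k. (\<phi> ^^ m (r k)) x) \<longlonglongrightarrow> blinfun_apply E x" for x
    using blinfun.tendsto [OF E tendsto_const, of x] by (simp add: B_apply)
  have pow: "\<omega> ((\<phi> ^^ n) x) ((\<psi> ^^ n) y) = \<omega> x y" for n x y
    by (induction n) (simp_all add: \<omega>(2))
  \<comment> \<open>Invariance under simultaneous powers of both maps passes to the limits
    \<open>F\<close> and \<open>G\<close>.\<close>
  have FG: "\<omega> (blinfun_apply F x) (blinfun_apply G y) = \<omega> x y" for x y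
  proof -
    have "(\<lambda>n. \<omega> ((\<phi> ^^ s n) x) ((\<psi> ^^ s n) y)) \<longlonglongrightarrow> \<omega> (blinfun_apply F x) (blinfun_apply G y)"
      using blinfun.tendsto [OF F tendsto_const, of x] blinfun.tendsto [OF G tendsto_const, of y]
      by (intro bounded_bilinear.tendsto [OF \<omega>(1)]) (simp_all add: B_apply)
    then show ?thesis
      unfolding pow by (metis LIMSEQ_unique tendsto_const)
  qed
  \<comment> \<open>Both sides are limits of the powers \<open>s (Suc (r k))\<close> of
    \<open>\<phi>\<close> at \<open>x\<close>. With \<open>FG\<close> this frees the first argument
    of \<open>\<omega>\<close> from the second: inserting \<open>F\<close> and \<open>G\<close>,
    then absorbing, gives the invariance under \<open>\<phi> (E x)\<close>.\<close>
  have absorb: "blinfun_apply F (\<phi> (blinfun_apply E x)) = blinfun_apply F x" for x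
  proof (rule LIMSEQ_unique)
    have "bounded_linear \<phi>"
      using lin(1) by (simp add: linear_conv_bounded_linear)
    from bounded_linear.tendsto [OF this E']
    have "(\<lambda>k. \<phi> ((\<phi> ^^ m (r k)) x)) \<longlonglongrightarrow> \<phi> (blinfun_apply E x)" .
    from blinfun.tendsto [OF LIMSEQ_subseq_LIMSEQ [OF F r] this]
    have "(\<lambda>k. (\<phi> ^^ s (r k)) (\<phi> ((\<phi> ^^ m (r k)) x))) \<longlonglongrightarrow> blinfun_apply F (\<phi> (blinfun_apply E x))"
      by (simp add: B_apply o_def)
    moreover have "(\<phi> ^^ s (r k)) (\<phi> ((\<phi> ^^ m (r k)) x)) = (\<phi> ^^ s (Suc (r k))) x" for k
      by (simp only: sm funpow_add o_apply funpow.simps)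
    ultimately show "(\<lambda>k. (\<phi> ^^ s (Suc (r k))) x) \<longlonglongrightarrow> blinfun_apply F (\<phi> (blinfun_apply E x))"
      by simp
    have "strict_mono (\<lambda>k. Suc (r k))"
      using r by (simp add: strict_mono_def)
    from blinfun.tendsto [OF LIMSEQ_subseq_LIMSEQ [OF F this] tendsto_const, of x]
    show "(\<lambda>k. (\<phi> ^^ s (Suc (r k))) x) \<longlonglongrightarrow> blinfun_apply F x"
      by (simp add: B_apply o_def)
  qed
  have "\<omega> (\<phi> (blinfun_apply E x)) y = \<omega> x y" for x y
    by (metis FG absorb)
  with E' show thesis
    by (rule that [where r = "\<lambda>k. m (r k)"])
qed

text \<open>The marginals of a \<open>joint\<close> map are of this kind. The class is closed under
  powers and pointwise limits and is uniformly bounded, as the recurrence argument requires.\<close>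

definition pos_unital :: "('a::finite operator \<Rightarrow> 'a operator) \<Rightarrow> bool"
  where "pos_unital \<phi> \<longleftrightarrow> linear \<phi> \<and> (\<forall>X. \<phi> (scale_op \<i> X) = scale_op \<i> (\<phi> X)) \<and>
    (\<forall>X. psd X \<longrightarrow> psd (\<phi> X)) \<and> \<phi> (mat 1) = mat 1"

lemma pos_unital_funpow: "pos_unital (\<phi> ^^ n)" if "pos_unital \<phi>"
proof -
  have "linear (\<phi> ^^ n)"
    using that by (intro linear_funpow) (simp add: pos_unital_def)
  moreover have "(\<phi> ^^ n) (scale_op \<i> X) = scale_op \<i> ((\<phi> ^^ n) X)" "(\<phi> ^^ n) (mat 1) = mat 1"
    and "psd X \<Longrightarrow> psd ((\<phi> ^^ n) X)" for X
    using that by (induction n) (simp_all add: pos_unital_def)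
  ultimately show ?thesis
    by (simp add: pos_unital_def)
qed

lemma pos_unital_limit:
  fixes E :: "'a::finite operator \<Rightarrow> 'a operator"
  assumes f: "\<And>k. pos_unital (f k)" and lim: "\<And>X. (\<lambda>k. f k X) \<longlonglongrightarrow> E X"
  shows "pos_unital E"
proof -
  have lin: "linear (f k)" for k
    using f by (simp add: pos_unital_def)
  have "linear E"
  proof (rule linearI)
    show "E (X + Y) = E X + E Y" for X Y
      using tendsto_add [OF lim [of X] lim [of Y]] lim [of "X + Y"]
      by (simp add: linear_add [OF lin] LIMSEQ_unique)
    show "E (c *\<^sub>R X) = c *\<^sub>R E X" for c X
      using tendsto_scaleR [OF tendsto_const lim [of X], of c] lim [of "c *\<^sub>R X"]
      by (simp add: linear_scale [OF lin] LIMSEQ_unique)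
  qed
  moreover have "E (scale_op \<i> X) = scale_op \<i> (E X)" for X
  proof (rule LIMSEQ_unique [OF lim])
    have "(\<lambda>k. scale_op \<i> (f k X)) \<longlonglongrightarrow> scale_op \<i> (E X)"
      by (intro vec_tendstoI) (simp add: tendsto_mult_left tendsto_vec_nth lim)
    then show "(\<lambda>k. f k (scale_op \<i> X)) \<longlonglongrightarrow> scale_op \<i> (E X)"
      using f by (simp add: pos_unital_def)
  qed
  moreover have "psd (E X)" if "psd X" for X
    unfolding psd_def
  proof
    fix v
    have "(\<lambda>k. cinner v (f k X *v v)) \<longlonglongrightarrow> cinner v (E X *v v)"
      unfolding cinner_def matrix_vector_mult_def
      by (simp, intro tendsto_intros tendsto_vec_nth lim)
    moreover have "cinner v (f k X *v v) \<in> \<real>\<^sub>\<ge>\<^sub>0" for k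
      using f that by (simp add: pos_unital_def psd_def)
    ultimately show "cinner v (E X *v v) \<in> \<real>\<^sub>\<ge>\<^sub>0"
      by (rule closed_sequentially [OF closed_nonneg_Reals_complex, rotated])
  qed
  moreover have "E (mat 1) = mat 1"
    using lim [of "mat 1"] f by (simp add: pos_unital_def LIMSEQ_const_iff)
  ultimately show ?thesis
    by (simp add: pos_unital_def)
qed

section \<open>Uniform norm bounds for positive unital maps\<close>

lemma linear_adj: "linear (adj :: 'a::finite operator \<Rightarrow> _)"
  by (rule linearI) simp_all

lemma linear_scale_op: "linear (scale_op c :: 'a::finite operator \<Rightarrow> _)"
  by (rule linearI) (simp_all add: vec_eq_iff algebra_simps)

lemma bilinear_matrix_vector_mult: "bilinear ((*v) :: 'a::finite operator \<Rightarrow> _)"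
  by (auto simp: bilinear_def matrix_vector_right_distrib matrix_vector_mult_add_rdistrib
      matrix_vector_scaleR intro!: linearI)

text \<open>Polarization and the parallelogram law turn the bound on the quadratic form into
  \<open>u \<bullet> (A *v v) \<le> c\<close> for unit vectors; normalising \<open>A *v v\<close> as
  \<open>u\<close> bounds the columns, hence the entries, and the cardinalities come from summing
  the entries.\<close>

lemma norm_operator_le:
  fixes A :: "'a::finite operator"
  assumes "hermitian A" "\<And>v. \<bar>v \<bullet> (A *v v)\<bar> \<le> c * (norm v)\<^sup>2"
  shows "norm A \<le> real (CARD('a) * CARD('a)) * c"
proof -
  have polar: "4 * (u \<bullet> (A *v v)) \<le> c * 4" if "norm u = 1" "norm v = 1" for u v
  proof -
    have "u \<bullet> (A *v v) = v \<bullet> (A *v u)"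
      using hermitian_inner [OF assms(1), of u v] by (simp add: inner_commute)
    then have "4 * (u \<bullet> (A *v v)) = (u + v) \<bullet> (A *v (u + v)) - (u - v) \<bullet> (A *v (u - v))"
      by (simp add: matrix_vector_right_distrib matrix_vector_mult_diff_distrib
          inner_add_left inner_diff_left inner_add_right inner_diff_right)
    also have "\<dots> \<le> c * (norm (u + v))\<^sup>2 + c * (norm (u - v))\<^sup>2"
      using assms(2) [of "u + v"] assms(2) [of "u - v"] by linarith
    also have "\<dots> = c * ((norm (u + v))\<^sup>2 + (norm (u - v))\<^sup>2)"
      by (simp add: distrib_left)
    also have "(norm (u + v))\<^sup>2 + (norm (u - v))\<^sup>2 = 2 * (norm u)\<^sup>2 + 2 * (norm v)\<^sup>2"
      by (simp add: power2_norm_eq_inner inner_add_left inner_diff_left inner_add_right inner_diff_right)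
    finally show ?thesis
      using that by simp
  qed
  have c: "0 \<le> c"
  proof -
    have "0 \<le> \<bar>axis undefined 1 \<bullet> (A *v axis undefined 1)\<bar>"
      by simp
    also have "\<dots> \<le> c * (norm (axis undefined 1 :: complex ^ 'a))\<^sup>2"
      by (rule assms(2))
    finally show ?thesis
      by simp
  qed
  have col: "norm (A *v v) \<le> c" if "norm v = 1" for v
  proof (cases "A *v v = 0")
    case False
    then have "(inverse (norm (A *v v)) *\<^sub>R (A *v v)) \<bullet> (A *v v) \<le> c"
      using polar [of "inverse (norm (A *v v)) *\<^sub>R (A *v v)" v] that by simp
    then show ?thesis
      using False by (simp add: power2_norm_eq_inner [symmetric] power2_eq_square field_simps)
  qed (simp add: c)
  have entry: "norm (A $ i $ j) \<le> c" for i j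
  proof -
    have "A $ i $ j = (A *v axis j 1) $ i"
      by (simp add: matrix_vector_mult_def axis_def mult_delta_right cong: if_cong)
    then show ?thesis
      using Finite_Cartesian_Product.norm_nth_le [of "A *v axis j 1" i] col [of "axis j 1"] by simp
  qed
  have "norm A \<le> (\<Sum>i\<in>UNIV. norm (A $ i))"
    unfolding norm_vec_def by (rule L2_set_le_sum) simp
  also have "\<dots> \<le> (\<Sum>i\<in>UNIV. \<Sum>j\<in>UNIV. norm (A $ i $ j))"
    by (intro sum_mono, subst norm_vec_def, rule L2_set_le_sum) simp
  also have "\<dots> \<le> (\<Sum>i\<in>(UNIV :: 'a set). \<Sum>j\<in>(UNIV :: 'a set). c)"
    by (intro sum_mono entry)
  finally show ?thesis
    by (simp add: mult.assoc)
qed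

text \<open>This is Cauchy-Schwarz; \<open>K\<close> compares the norm of a matrix, that of its
  entries, with its action on vectors.\<close>

lemma hermitian_dominated:
  "\<exists>K>0. \<forall>H :: 'a::finite operator. hermitian H \<longrightarrow>
    psd ((K * norm H) *\<^sub>R mat 1 - H) \<and> psd ((K * norm H) *\<^sub>R mat 1 + H)"
proof -
  obtain K where K: "K > 0" "\<And>(X :: 'a operator) v. norm (X *v v) \<le> K * norm X * norm v"
    using bilinear_bounded_pos [OF bilinear_matrix_vector_mult] by blast
  have "psd ((K * norm H) *\<^sub>R mat 1 - H) \<and> psd ((K * norm H) *\<^sub>R mat 1 + H)" if H: "hermitian H"
    for H :: "'a operator"
  proof (intro conjI psdI)
    show "hermitian ((K * norm H) *\<^sub>R mat 1 - H)" "hermitian ((K * norm H) *\<^sub>R mat 1 + H)"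
      by (intro hermitian_simps H)+
    fix v
    have "\<bar>v \<bullet> (H *v v)\<bar> \<le> norm v * norm (H *v v)"
      by (rule Cauchy_Schwarz_ineq2)
    also have "\<dots> \<le> norm v * (K * norm H * norm v)"
      by (intro mult_left_mono K) simp
    finally have "\<bar>v \<bullet> (H *v v)\<bar> \<le> K * norm H * (v \<bullet> v)"
      by (simp add: mult_ac power2_norm_eq_inner [symmetric] power2_eq_square)
    then show "0 \<le> v \<bullet> (((K * norm H) *\<^sub>R mat 1 - H) *v v)" "0 \<le> v \<bullet> (((K * norm H) *\<^sub>R mat 1 + H) *v v)"
      by (simp_all add: matrix_vector_mult_diff_rdistrib matrix_vector_mult_add_rdistrib
          matrix_vector_scaleR inner_diff_right inner_add_right abs_le_iff)
  qed
  with K(1) show ?thesis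
    by blast
qed

text \<open>\<open>H1\<close> and \<open>H2\<close> are the real and the imaginary part of
  \<open>X\<close>; note that \<open>\<i> / 2\<close> times \<open>adj X - X\<close> is
  \<open>X - adj X\<close> divided by \<open>2 * \<i>\<close>.\<close>

lemma cartesian_decomposition:
  fixes X :: "'a::finite operator"
  defines "H1 \<equiv> (1/2) *\<^sub>R (X + adj X)" and "H2 \<equiv> scale_op \<i> ((1/2) *\<^sub>R (adj X - X))"
  shows "X = H1 + scale_op \<i> H2" "hermitian H1" "hermitian H2"
proof -
  have "X $ i $ j = H1 $ i $ j + \<i> * H2 $ i $ j" for i j
    by (rule complex_eqI; simp add: H1_def H2_def adj_def field_simps)
  then show "X = H1 + scale_op \<i> H2"
    by (simp add: vec_eq_iff)
  have "cnj (H1 $ j $ i) = H1 $ i $ j" "cnj (H2 $ j $ i) = H2 $ i $ j" for i j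
    by (rule complex_eqI; simp add: H1_def H2_def adj_def field_simps)+
  then show "hermitian H1" "hermitian H2"
    by (simp_all add: hermitian_def vec_eq_iff adj_def)
qed

text \<open>A Hermitian \<open>H\<close> lies between two opposite multiples of the identity, and a
  positive unital map preserves these bounds; other operators are split into real and imaginary
  part. One \<open>C\<close> serves all maps, in particular all powers of one map.\<close>

lemma pos_unital_bounded:
  "\<exists>C. \<forall>\<phi>. pos_unital \<phi> \<longrightarrow> (\<forall>X :: 'a::finite operator. norm (\<phi> X) \<le> C * norm X)"
proof -
  obtain K where K: "K > 0" and dom: "\<And>H :: 'a operator. hermitian H \<Longrightarrow>
      psd ((K * norm H) *\<^sub>R mat 1 - H) \<and> psd ((K * norm H) *\<^sub>R mat 1 + H)"
    using hermitian_dominated [where 'a = 'a] by blast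
  obtain L where L: "L > 0" "\<And>X :: 'a operator. norm (adj X) \<le> L * norm X"
    using linear_bounded_pos [OF linear_adj] by blast
  obtain M where M: "M > 0" "\<And>X :: 'a operator. norm (scale_op \<i> X) \<le> M * norm X"
    using linear_bounded_pos [OF linear_scale_op] by blast
  define N where "N = real (CARD('a) * CARD('a)) * K"
  have herm: "norm (\<phi> H) \<le> N * norm H" if \<phi>: "pos_unital \<phi>" and H: "hermitian H"
    for \<phi> and H :: "'a operator"
  proof -
    define c where "c = K * norm H"
    have lin: "linear \<phi>" and one: "\<phi> (mat 1) = mat 1" and pos: "\<And>X. psd X \<Longrightarrow> psd (\<phi> X)"
      using \<phi> by (auto simp: pos_unital_def)
    have "psd (c *\<^sub>R mat 1 - H)" "psd (c *\<^sub>R mat 1 + H)"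
      using dom [OF H] by (simp_all add: c_def)
    from this [THEN pos] have psd: "psd (c *\<^sub>R mat 1 - \<phi> H)" "psd (c *\<^sub>R mat 1 + \<phi> H)"
      by (simp_all add: linear_diff [OF lin] linear_add [OF lin] linear_scale [OF lin] one)
    have "hermitian (\<phi> H)"
      using hermitian_simps(2) [OF psd_hermitian [OF psd(2)] hermitian_simps(3) [OF hermitian_simps(4), of c]]
      by simp
    moreover have "\<bar>v \<bullet> (\<phi> H *v v)\<bar> \<le> c * (norm v)\<^sup>2" for v
      using psd_inner [OF psd(1), of v] psd_inner [OF psd(2), of v]
      by (simp add: matrix_vector_mult_diff_rdistrib matrix_vector_mult_add_rdistrib
            matrix_vector_scaleR inner_diff_right inner_add_right abs_le_iff power2_norm_eq_inner)
    ultimately have "norm (\<phi> H) \<le> real (CARD('a) * CARD('a)) * c"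
      by (rule norm_operator_le)
    then show ?thesis
      by (simp add: N_def c_def mult.assoc)
  qed
  have "norm (\<phi> X) \<le> (N * (1 + L) + M * (N * (M * (1 + L)))) * norm X" if \<phi>: "pos_unital \<phi>" for \<phi> and X :: "'a operator"
  proof -
    define H1 where "H1 = (1/2) *\<^sub>R (X + adj X)"
    define H2 where "H2 = scale_op \<i> ((1/2) *\<^sub>R (adj X - X))"
    have X: "X = H1 + scale_op \<i> H2" and hH: "hermitian H1" "hermitian H2"
      using cartesian_decomposition [of X] by (simp_all add: H1_def H2_def)
    have half: "norm ((1/2) *\<^sub>R Y) \<le> norm Y" for Y :: "'a operator"
      by simp
    have nX: "norm ((1/2) *\<^sub>R (X + adj X)) \<le> (1 + L) * norm X"
      using L(2) [of X] order_trans [OF half norm_triangle_ineq, of X "adj X"] by (simp add: distrib_right)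
    have nX': "norm ((1/2) *\<^sub>R (adj X - X)) \<le> (1 + L) * norm X"
      using L(2) [of X] order_trans [OF half norm_triangle_ineq4, of "adj X" X] by (simp add: distrib_right)
    have N0: "0 \<le> N"
      using K by (simp add: N_def)
    have "norm (\<phi> X) = norm (\<phi> H1 + scale_op \<i> (\<phi> H2))"
      using \<phi> by (subst X) (simp add: pos_unital_def linear_add)
    also have "\<dots> \<le> norm (\<phi> H1) + norm (scale_op \<i> (\<phi> H2))"
      by (rule norm_triangle_ineq)
    also have "\<dots> \<le> N * norm H1 + M * (N * norm H2)"
      using herm [OF \<phi> hH(1)] herm [OF \<phi> hH(2)] M
      by (intro add_mono order_trans [OF M(2)] mult_left_mono) auto
    also have "\<dots> \<le> N * ((1 + L) * norm X) + M * (N * (M * ((1 + L) * norm X)))"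
    proof (intro add_mono mult_left_mono)
      show "norm H1 \<le> (1 + L) * norm X"
        using nX by (simp add: H1_def)
      show "norm H2 \<le> M * ((1 + L) * norm X)"
        unfolding H2_def using M nX' by (intro order_trans [OF M(2)] mult_left_mono) auto
    qed (use N0 M in auto)
    finally show ?thesis
      by (simp add: algebra_simps)
  qed
  then show ?thesis
    by blast
qed

section \<open>Commutation of steered operators\<close>

lemma joint_pos_unital: "pos_unital (\<lambda>X. \<beta> X (mat 1))" "pos_unital (\<lambda>X. \<beta> (mat 1) X)" if "joint \<beta>"
  using that by (simp_all add: joint_def pos_unital_def bilinear_def psd_mat1)

lemma joint_compose: "joint (\<lambda>X Y. \<beta> (\<phi> X) (\<psi> Y))" if "joint \<beta>" "pos_unital \<phi>" "pos_unital \<psi>"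
proof -
  have "linear \<phi>" "linear \<psi>" and "linear (\<lambda>X. \<beta> X Y)" "linear (\<lambda>X. \<beta> Y X)" for Y
    using that by (simp_all add: joint_def pos_unital_def bilinear_def)
  then have "linear (\<lambda>X. \<beta> (\<phi> X) Y)" "linear (\<lambda>X. \<beta> Y (\<psi> X))" for Y
    by (simp_all add: linear_iff)
  then show ?thesis
    using that unfolding joint_def pos_unital_def bilinear_def by simp
qed

lemma matrix_add_rdistrib: "(X + Y) ** Z = X ** Z + Y ** Z" for X Y Z :: "'a::finite operator"
  by (simp add: vec_eq_iff matrix_matrix_mult_def distrib_right sum.distrib)

lemma bounded_bilinear_trace:
  fixes T :: "'b::finite operator \<Rightarrow> 'a::finite operator"
  assumes "linear T"
  shows "bounded_bilinear (\<lambda>X Y. trace (X ** T Y))"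
proof -
  have "bilinear (\<lambda>X Y. trace (X ** T Y))"
    using assms
    by (simp add: bilinear_def linear_iff matrix_add_ldistrib matrix_add_rdistrib
        matrix_mult_scaleR trace_simps)
  then show ?thesis
    by (simp add: bilinear_conv_bounded_bilinear)
qed

text \<open>A Hermitian operator becomes positive after adding a multiple of the identity.\<close>

lemma positive_map_hermitian:
  fixes T :: "'b::finite operator \<Rightarrow> 'a::finite operator"
  assumes T: "linear T" "\<And>Y. psd Y \<Longrightarrow> psd (T Y)" and "hermitian Y"
  shows "hermitian (T Y)"
proof -
  obtain c :: real where "psd (c *\<^sub>R mat 1 + Y)"
    using hermitian_dominated [where 'a = 'b] assms(3) by blast
  then have "hermitian (T (c *\<^sub>R mat 1 + Y) - c *\<^sub>R T (mat 1))"
    by (intro hermitian_simps(2,3) psd_hermitian T psd_mat1)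
  then show ?thesis
    by (simp add: linear_add [OF T(1)] linear_scale [OF T(1)])
qed

text \<open>\<open>T Y\<close> is the operator of one side steered by \<open>Y\<close> on the other.
  The invariance of \<open>trace (X ** T Y)\<close> is given only for the marginals of both sides
  together; \<open>rec\<close> trades it for invariance under a map that acts on \<open>X\<close>
  alone.\<close>

lemma steered_commute:
  fixes T :: "'b::finite operator \<Rightarrow> 'a::finite operator"
  assumes A: "joint \<alpha>" and B: "joint \<beta>" and T: "linear T" "\<And>Y. psd Y \<Longrightarrow> psd (T Y)"
    and inv1: "\<And>X Y. trace (\<alpha> X (mat 1) ** T (\<beta> Y (mat 1))) = trace (X ** T Y)"
    and inv2: "\<And>X Y. trace (\<alpha> (mat 1) X ** T (\<beta> (mat 1) Y)) = trace (X ** T Y)"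
    and "hermitian Y" "hermitian Y'"
  shows "T Y ** T Y' = T Y' ** T Y"
proof -
  have rec: "\<exists>E. pos_unital E \<and> (\<forall>X Y. trace (\<phi> (E X) ** T Y) = trace (X ** T Y))"
    if \<phi>: "pos_unital \<phi>" and \<psi>: "pos_unital \<psi>" and inv: "\<And>X Y. trace (\<phi> X ** T (\<psi> Y)) = trace (X ** T Y)" for \<phi> \<psi>
  proof -
    obtain C where C: "\<And>\<phi> X. pos_unital \<phi> \<Longrightarrow> norm (\<phi> (X :: 'a operator)) \<le> C * norm X"
      using pos_unital_bounded [where 'a = 'a] by blast
    obtain D where D: "\<And>\<phi> X. pos_unital \<phi> \<Longrightarrow> norm (\<phi> (X :: 'b operator)) \<le> D * norm X"
      using pos_unital_bounded [where 'a = 'b] by blast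
    have lin: "linear \<phi>" "linear \<psi>"
      using \<phi> \<psi> by (simp_all add: pos_unital_def)
    show ?thesis
    proof (rule recurrence [where \<omega> = "\<lambda>X Y. trace (X ** T Y)",
          OF lin C [OF pos_unital_funpow [OF \<phi>]] D [OF pos_unital_funpow [OF \<psi>]]
          bounded_bilinear_trace [OF T(1)] inv])
      fix r :: "nat \<Rightarrow> nat" and E
      assume "\<And>X. (\<lambda>k. (\<phi> ^^ r k) X) \<longlonglongrightarrow> E X"
      with pos_unital_funpow [OF \<phi>] have "pos_unital E"
        by (rule pos_unital_limit)
      moreover assume "\<And>X Y. trace (\<phi> (E X) ** T Y) = trace (X ** T Y)"
      ultimately show ?thesis
        by blast
    qed
  qed
  obtain E1 where E1: "pos_unital E1" "\<And>X Y. trace (\<alpha> (E1 X) (mat 1) ** T Y) = trace (X ** T Y)"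
    using rec [OF joint_pos_unital(1) [OF A] joint_pos_unital(1) [OF B] inv1] by blast
  obtain E2 where E2: "pos_unital E2" "\<And>X Y. trace (\<alpha> (mat 1) (E2 X) ** T Y) = trace (X ** T Y)"
    using rec [OF joint_pos_unital(2) [OF A] joint_pos_unital(2) [OF B] inv2] by blast
  let ?R = "T ` {Y. hermitian Y}"
  have dom: "\<exists>c::real. psd (c *\<^sub>R mat 1 - Y) \<and> psd (c *\<^sub>R mat 1 + Y)" if "hermitian Y" for Y :: "'b operator"
    using hermitian_dominated [where 'a = 'b] that by blast
  have dom': "\<exists>c::real. psd (c *\<^sub>R T (mat 1) - T Y) \<and> psd (c *\<^sub>R T (mat 1) + T Y)" if Y: "hermitian Y" for Y
  proof -
    obtain c :: real where "psd (c *\<^sub>R mat 1 - Y)" "psd (c *\<^sub>R mat 1 + Y)"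
      using dom [OF Y] by blast
    from this [THEN T(2)] show ?thesis
      by (auto simp: linear_diff [OF T(1)] linear_add [OF T(1)] linear_scale [OF T(1)])
  qed
  show ?thesis
  \<comment> \<open>Since \<open>E1\<close> and \<open>E2\<close> fix \<open>mat 1\<close>, the
    marginals of the composed map are \<open>\<alpha> (E1 X) (mat 1)\<close> and
    \<open>\<alpha> (mat 1) (E2 X)\<close>, each of which preserves the expectations in all
    \<open>T Y\<close>.\<close>
  proof (rule joint_commute [OF joint_compose [OF A E1(1) E2(1)], of ?R "T (mat 1)"])
    have "subspace {Y :: 'b operator. hermitian Y}"
      by (simp add: subspace_def hermitian_simps)
    then show "subspace ?R"
      using T(1) by (rule linear_subspace_image [rotated])
    show "hermitian X" if X: "X \<in> ?R" for X
      using X positive_map_hermitian [OF T] by blast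
    show "T (mat 1) \<in> ?R"
      by (simp add: hermitian_simps)
    show "psd (T (mat 1))"
      by (intro T psd_mat1)
    \<comment> \<open>\<open>X\<close> lies between opposite multiples of \<open>T (mat 1)\<close>,
      so its form vanishes at \<open>v\<close>, and \<open>v\<close> is in the kernel of the
      positive operator \<open>c *\<^sub>R T (mat 1) + X\<close>.\<close>
    show "X *v v = 0" if X: "X \<in> ?R" and v: "T (mat 1) *v v = 0" for X v
    proof -
      obtain Y where Y: "X = T Y" "hermitian Y"
        using X by blast
      obtain c :: real where c: "psd (c *\<^sub>R T (mat 1) - X)" "psd (c *\<^sub>R T (mat 1) + X)"
        using dom' [OF Y(2)] Y(1) by blast
      have v': "(c *\<^sub>R T (mat 1) - X) *v v = - (X *v v)" "(c *\<^sub>R T (mat 1) + X) *v v = X *v v"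
        by (simp_all add: matrix_vector_mult_diff_rdistrib matrix_vector_mult_add_rdistrib
            matrix_vector_scaleR v)
      then have "v \<bullet> (X *v v) = 0"
        using psd_inner [OF c(1), of v] psd_inner [OF c(2), of v] by simp
      then show ?thesis
        using psd_kernel [OF c(2), of v] v' by simp
    qed
    show "T Y \<in> ?R" "T Y' \<in> ?R"
      using assms by auto
    show "trace (\<alpha> (E1 Z) (E2 (mat 1)) ** X) = trace (Z ** X)" if "X \<in> ?R" for X Z
      using that E1(2) E2(1) by (auto simp: pos_unital_def)
    show "trace (\<alpha> (E1 (mat 1)) (E2 Z) ** X) = trace (Z ** X)" if "X \<in> ?R" for X Z
      using that E2(2) E1(1) by (auto simp: pos_unital_def)
  qed
qed

subsection \<open>Tensor products and steering\<close>

definition tensor_vec :: "complex ^ 'a::finite \<Rightarrow> complex ^ 'b::finite \<Rightarrow> complex ^ ('a \<times> 'b)"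
  where "tensor_vec u v = (\<chi> p. u $ fst p * v $ snd p)"

lemma tensor_op_ketbra:
  "tensor_op (ketbra u u') (ketbra v v') = ketbra (tensor_vec u v) (tensor_vec u' v')"
  by (simp add: vec_eq_iff ketbra_def tensor_vec_def mult_ac)

lemma sum_UNIV_prod: "(\<Sum>p\<in>UNIV. f p) = (\<Sum>a\<in>UNIV. \<Sum>b\<in>UNIV. f (a, b))"
  for f :: "'a::finite \<times> 'b::finite \<Rightarrow> 'c::comm_monoid_add"
  by (simp add: sum.cartesian_product)

lemma cinner_tensor_vec: "cinner (tensor_vec u v) (tensor_vec u' v') = cinner u u' * cinner v v'"
  by (simp add: cinner_def tensor_vec_def sum_UNIV_prod sum_product mult_ac)

lemma tensor_op_simps:
  "tensor_op (X + X') Y = tensor_op X Y + tensor_op X' Y"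
  "tensor_op X (Y + Y') = tensor_op X Y + tensor_op X Y'"
  "tensor_op (r *\<^sub>R X) Y = r *\<^sub>R tensor_op X Y"
  "tensor_op X (r *\<^sub>R Y) = r *\<^sub>R tensor_op X Y"
  "tensor_op (scale_op c X) Y = scale_op c (tensor_op X Y)"
  "tensor_op X (scale_op c Y) = scale_op c (tensor_op X Y)"
  "tensor_op 0 Y = 0" "tensor_op X 0 = 0"
  by (simp_all add: vec_eq_iff algebra_simps)

lemma tensor_op_sum:
  "tensor_op (sum f A) Y = (\<Sum>x\<in>A. tensor_op (f x) Y)"
  "tensor_op X (sum g A) = (\<Sum>x\<in>A. tensor_op X (g x))"
  by (induction A rule: infinite_finite_induct) (simp_all add: tensor_op_simps)

lemma tensor_op_mat1: "tensor_op (mat 1) (mat 1) = mat 1"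
  by (auto simp: vec_eq_iff mat_def prod_eq_iff)

lemma trace_ketbra: "trace (ketbra u v) = cinner v u"
  by (simp add: trace_def ketbra_def cinner_def mult.commute)

lemma trace_scale_op: "trace (scale_op c X) = c * trace X"
  by (simp add: trace_def sum_distrib_left)

lemma matrix_mult_scale_op:
  "X ** scale_op c Y = scale_op c (X ** Y)" "scale_op c X ** Y = scale_op c (X ** Y)"
  for X Y :: "'a::finite operator"
  by (simp_all add: vec_eq_iff matrix_matrix_mult_def sum_distrib_left mult_ac)

lemma trace_tensor_op: "trace (tensor_op X Y) = trace X * trace Y"
  by (simp add: trace_def sum_UNIV_prod sum_product)

lemma tensor_op_mult: "tensor_op X Y ** tensor_op X' Y' = tensor_op (X ** X') (Y ** Y')"
  for X X' :: "'a::finite operator" and Y Y' :: "'b::finite operator"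
  by (simp add: vec_eq_iff matrix_matrix_mult_def sum_UNIV_prod sum_product mult_ac)

text \<open>The spectral decompositions of the factors write the product as a nonnegative
  combination of rank-one projections onto product vectors.\<close>

lemma psd_tensor_op:
  fixes X :: "'a::finite operator" and Y :: "'b::finite operator"
  assumes "psd X" "psd Y"
  shows "psd (tensor_op X Y)"
proof -
  obtain B and l :: "complex ^ 'a \<Rightarrow> real" where B: "onb B" "\<And>u. u \<in> B \<Longrightarrow> X *v u = l u *\<^sub>R u"
    and l: "\<And>u. u \<in> B \<Longrightarrow> 0 \<le> l u"
    using psd_spectral [OF assms(1)] by blast
  have X: "X = (\<Sum>u\<in>B. l u *\<^sub>R ketbra u u)"
    by (rule onb_diag_eq [OF B])
  obtain C and m :: "complex ^ 'b \<Rightarrow> real" where C: "onb C" "\<And>u. u \<in> C \<Longrightarrow> Y *v u = m u *\<^sub>R u"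
    and m: "\<And>u. u \<in> C \<Longrightarrow> 0 \<le> m u"
    using psd_spectral [OF assms(2)] by blast
  have Y: "Y = (\<Sum>u\<in>C. m u *\<^sub>R ketbra u u)"
    by (rule onb_diag_eq [OF C])
  show ?thesis
    unfolding X Y tensor_op_sum tensor_op_simps tensor_op_ketbra
    using l m by (intro psd_sum psd_scaleR psd_ketbra) auto
qed

section \<open>Steering, and duality for channels and partial traces\<close>

lemma trace_mult: "trace (X ** Y) = (\<Sum>i\<in>UNIV. \<Sum>j\<in>UNIV. X $ i $ j * Y $ j $ i)"
  for X Y :: "'a::finite operator"
  by (simp add: trace_def matrix_matrix_mult_def)

text \<open>This is the partial trace over B of \<open>(1 \<otimes> Y) \<rho>\<close>: for an effect
  \<open>Y\<close>, the unnormalised state of A after that outcome at B.\<close>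

definition steer_A :: "('a::finite \<times> 'b::finite) operator \<Rightarrow> 'b operator \<Rightarrow> 'a operator"
  where "steer_A \<rho> Y = (\<chi> i j. \<Sum>k\<in>UNIV. \<Sum>l\<in>UNIV. Y $ l $ k * \<rho> $ (i, k) $ (j, l))"

definition steer_B :: "('a::finite \<times> 'b::finite) operator \<Rightarrow> 'a operator \<Rightarrow> 'b operator"
  where "steer_B \<rho> X = (\<chi> k l. \<Sum>i\<in>UNIV. \<Sum>j\<in>UNIV. X $ j $ i * \<rho> $ (i, k) $ (j, l))"

lemma trace_steer:
  "trace (X ** steer_A \<rho> Y) = trace (tensor_op X Y ** \<rho>)"
  "trace (Y ** steer_B \<rho> X) = trace (tensor_op X Y ** \<rho>)"
proof -
  have tr: "trace (tensor_op X Y ** \<rho>)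
    = (\<Sum>j\<in>UNIV. \<Sum>l\<in>UNIV. \<Sum>i\<in>UNIV. \<Sum>k\<in>UNIV. X $ j $ i * Y $ l $ k * \<rho> $ (i, k) $ (j, l))"
    by (simp add: trace_mult sum_UNIV_prod)
  also have "\<dots> = (\<Sum>j\<in>UNIV. \<Sum>i\<in>UNIV. \<Sum>l\<in>UNIV. \<Sum>k\<in>UNIV. X $ j $ i * Y $ l $ k * \<rho> $ (i, k) $ (j, l))"
    by (intro sum.cong refl sum.swap)
  also have "\<dots> = (\<Sum>j\<in>UNIV. \<Sum>i\<in>UNIV. \<Sum>k\<in>UNIV. \<Sum>l\<in>UNIV. X $ j $ i * Y $ l $ k * \<rho> $ (i, k) $ (j, l))"
    by (intro sum.cong refl sum.swap)
  also have "\<dots> = trace (X ** steer_A \<rho> Y)"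
    by (simp add: trace_mult steer_A_def sum_distrib_left mult.assoc)
  finally show "trace (X ** steer_A \<rho> Y) = trace (tensor_op X Y ** \<rho>)"
    by simp
  have "trace (tensor_op X Y ** \<rho>)
    = (\<Sum>l\<in>UNIV. \<Sum>j\<in>UNIV. \<Sum>i\<in>UNIV. \<Sum>k\<in>UNIV. X $ j $ i * Y $ l $ k * \<rho> $ (i, k) $ (j, l))"
    unfolding tr by (rule sum.swap)
  also have "\<dots> = (\<Sum>l\<in>UNIV. \<Sum>j\<in>UNIV. \<Sum>k\<in>UNIV. \<Sum>i\<in>UNIV. X $ j $ i * Y $ l $ k * \<rho> $ (i, k) $ (j, l))"
    by (intro sum.cong refl sum.swap)
  also have "\<dots> = (\<Sum>l\<in>UNIV. \<Sum>k\<in>UNIV. \<Sum>j\<in>UNIV. \<Sum>i\<in>UNIV. X $ j $ i * Y $ l $ k * \<rho> $ (i, k) $ (j, l))"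
    by (intro sum.cong refl sum.swap)
  also have "\<dots> = (\<Sum>l\<in>UNIV. \<Sum>k\<in>UNIV. \<Sum>i\<in>UNIV. \<Sum>j\<in>UNIV. X $ j $ i * Y $ l $ k * \<rho> $ (i, k) $ (j, l))"
    by (intro sum.cong refl sum.swap)
  also have "\<dots> = trace (Y ** steer_B \<rho> X)"
    by (simp add: trace_mult steer_B_def sum_distrib_left mult_ac)
  finally show "trace (Y ** steer_B \<rho> X) = trace (tensor_op X Y ** \<rho>)"
    by simp
qed

lemma cinner_eq_trace: "cinner v (Z *v v) = trace (ketbra v v ** Z)" for Z :: "'a::finite operator"
  by (simp add: trace_mult_ketbra trace_mul_sym [of "ketbra v v"])

text \<open>An expectation of a steered operator is the trace of \<open>\<rho>\<close> against a
  product of two positive operators.\<close>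

lemma psd_steer:
  assumes "psd \<rho>"
  shows "psd Y \<Longrightarrow> psd (steer_A \<rho> Y)" "psd X \<Longrightarrow> psd (steer_B \<rho> X)"
  unfolding psd_def [of "steer_A \<rho> Y"] psd_def [of "steer_B \<rho> X"] cinner_eq_trace trace_steer
  by (auto intro!: trace_psd_mult(1) psd_tensor_op psd_ketbra assms)

lemma steer_simps:
  "steer_A \<rho> (Y + Y') = steer_A \<rho> Y + steer_A \<rho> Y'" "steer_A \<rho> (r *\<^sub>R Y) = r *\<^sub>R steer_A \<rho> Y"
  "steer_A \<rho> (scale_op c Y) = scale_op c (steer_A \<rho> Y)"
  "steer_B \<rho> (X + X') = steer_B \<rho> X + steer_B \<rho> X'" "steer_B \<rho> (r *\<^sub>R X) = r *\<^sub>R steer_B \<rho> X"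
  "steer_B \<rho> (scale_op c X) = scale_op c (steer_B \<rho> X)"
  by (simp_all add: vec_eq_iff steer_A_def steer_B_def algebra_simps sum.distrib sum_distrib_left
      scaleR_sum_right)

text \<open>The adjoint of \<open>\<Theta>\<close> for the trace pairing without conjugation, which
  is why the indices \<open>j\<close> and \<open>i\<close> appear in reverse order.\<close>

definition heisenberg :: "('a::finite operator \<Rightarrow> 'b::finite operator) \<Rightarrow> 'b operator \<Rightarrow> 'a operator"
  where "heisenberg \<Theta> P = (\<chi> j i. trace (P ** \<Theta> (ketbra (axis i 1) (axis j 1))))"

lemma trace_heisenberg:
  assumes "Vector_Spaces.linear scale_op scale_op \<Theta>"
  shows "trace (heisenberg \<Theta> P ** X) = trace (P ** \<Theta> X)"
proof -
  interpret Vector_Spaces.linear scale_op scale_op \<Theta>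
    by (fact assms)
  have "\<Theta> X = (\<Sum>i\<in>UNIV. \<Sum>j\<in>UNIV. scale_op (X $ i $ j) (\<Theta> (ketbra (axis i 1) (axis j 1))))"
    by (subst operator_basis_expansion) (simp add: sum scale)
  then have "trace (P ** \<Theta> X) = (\<Sum>i\<in>UNIV. \<Sum>j\<in>UNIV. heisenberg \<Theta> P $ j $ i * X $ i $ j)"
    by (simp add: matrix_mult_sum_right trace_sum matrix_mult_scale_op trace_scale_op
        heisenberg_def mult.commute)
  also have "\<dots> = trace (heisenberg \<Theta> P ** X)"
    unfolding trace_mult by (rule sum.swap)
  finally show ?thesis
    by simp
qed

lemma trace_tensor_map:
  "trace (tensor_op P Q ** tensor_map \<Phi> \<Psi> \<rho>)
    = trace (tensor_op (heisenberg \<Phi> P) (heisenberg \<Psi> Q) ** \<rho>)"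
proof -
  let ?f = "\<lambda>i j k l. heisenberg \<Phi> P $ j $ i * heisenberg \<Psi> Q $ l $ k * \<rho> $ (i, k) $ (j, l)"
  have "trace (tensor_op P Q ** tensor_map \<Phi> \<Psi> \<rho>) = (\<Sum>i\<in>UNIV. \<Sum>j\<in>UNIV. \<Sum>k\<in>UNIV. \<Sum>l\<in>UNIV. ?f i j k l)"
    by (simp add: tensor_map_def matrix_mult_sum_right trace_sum matrix_mult_scale_op trace_scale_op
        tensor_op_mult trace_tensor_op heisenberg_def mult_ac)
  also have "\<dots> = (\<Sum>j\<in>UNIV. \<Sum>i\<in>UNIV. \<Sum>k\<in>UNIV. \<Sum>l\<in>UNIV. ?f i j k l)"
    by (rule sum.swap)
  also have "\<dots> = (\<Sum>j\<in>UNIV. \<Sum>i\<in>UNIV. \<Sum>l\<in>UNIV. \<Sum>k\<in>UNIV. ?f i j k l)"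
    by (intro sum.cong refl sum.swap)
  also have "\<dots> = (\<Sum>j\<in>UNIV. \<Sum>l\<in>UNIV. \<Sum>i\<in>UNIV. \<Sum>k\<in>UNIV. ?f i j k l)"
    by (intro sum.cong refl sum.swap)
  also have "\<dots> = trace (tensor_op (heisenberg \<Phi> P) (heisenberg \<Psi> Q) ** \<rho>)"
    by (simp add: trace_mult sum_UNIV_prod)
  finally show ?thesis .
qed

text \<open>Discarding a copy is dual to inserting \<open>mat 1\<close> there; the proof rearranges
  the six sums.\<close>

lemma trace_reduction:
  fixes X :: "'a::finite operator" and Y :: "'b::finite operator"
  shows "trace (tensor_op X Y ** reduction_AB \<sigma>)
      = trace (tensor_op (tensor_op X (mat 1)) (tensor_op Y (mat 1)) ** \<sigma>)"
    and "trace (tensor_op X Y ** reduction_A'B' \<sigma>)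
      = trace (tensor_op (tensor_op (mat 1) X) (tensor_op (mat 1) Y) ** \<sigma>)"
proof -
  have reorder: "(\<Sum>a\<in>UNIV. \<Sum>b\<in>UNIV. \<Sum>c\<in>UNIV. \<Sum>d\<in>UNIV. \<Sum>a'\<in>UNIV. \<Sum>b'\<in>UNIV. f a b c d a' b')
      = (\<Sum>a\<in>UNIV. \<Sum>a'\<in>UNIV. \<Sum>b\<in>UNIV. \<Sum>b'\<in>UNIV. \<Sum>c\<in>UNIV. \<Sum>d\<in>UNIV. f a b c d a' b')"
    for f :: "'a \<Rightarrow> 'b \<Rightarrow> 'a \<Rightarrow> 'b \<Rightarrow> 'a \<Rightarrow> 'b \<Rightarrow> complex"
  proof (rule sum.cong [OF refl])
    fix a
    have "(\<Sum>b\<in>UNIV. \<Sum>c\<in>UNIV. \<Sum>d\<in>UNIV. \<Sum>a'\<in>UNIV. \<Sum>b'\<in>UNIV. f a b c d a' b')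
        = (\<Sum>b\<in>UNIV. \<Sum>c\<in>UNIV. \<Sum>a'\<in>UNIV. \<Sum>d\<in>UNIV. \<Sum>b'\<in>UNIV. f a b c d a' b')"
      by (intro sum.cong refl sum.swap)
    also have "\<dots> = (\<Sum>b\<in>UNIV. \<Sum>a'\<in>UNIV. \<Sum>c\<in>UNIV. \<Sum>d\<in>UNIV. \<Sum>b'\<in>UNIV. f a b c d a' b')"
      by (intro sum.cong refl sum.swap)
    also have "\<dots> = (\<Sum>a'\<in>UNIV. \<Sum>b\<in>UNIV. \<Sum>c\<in>UNIV. \<Sum>d\<in>UNIV. \<Sum>b'\<in>UNIV. f a b c d a' b')"
      by (rule sum.swap)
    also have "\<dots> = (\<Sum>a'\<in>UNIV. \<Sum>b\<in>UNIV. \<Sum>c\<in>UNIV. \<Sum>b'\<in>UNIV. \<Sum>d\<in>UNIV. f a b c d a' b')"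
      by (intro sum.cong refl sum.swap)
    also have "\<dots> = (\<Sum>a'\<in>UNIV. \<Sum>b\<in>UNIV. \<Sum>b'\<in>UNIV. \<Sum>c\<in>UNIV. \<Sum>d\<in>UNIV. f a b c d a' b')"
      by (intro sum.cong refl sum.swap)
    finally show "(\<Sum>b\<in>UNIV. \<Sum>c\<in>UNIV. \<Sum>d\<in>UNIV. \<Sum>a'\<in>UNIV. \<Sum>b'\<in>UNIV. f a b c d a' b')
        = (\<Sum>a'\<in>UNIV. \<Sum>b\<in>UNIV. \<Sum>b'\<in>UNIV. \<Sum>c\<in>UNIV. \<Sum>d\<in>UNIV. f a b c d a' b')" .
  qed
  have reorder': "(\<Sum>a\<in>UNIV. \<Sum>b\<in>UNIV. \<Sum>c\<in>UNIV. \<Sum>d\<in>UNIV. \<Sum>a'\<in>UNIV. \<Sum>b'\<in>UNIV. f a b c d a' b')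
      = (\<Sum>a'\<in>UNIV. \<Sum>a\<in>UNIV. \<Sum>b'\<in>UNIV. \<Sum>b\<in>UNIV. \<Sum>c\<in>UNIV. \<Sum>d\<in>UNIV. f a b c d a' b')"
    for f :: "'a \<Rightarrow> 'b \<Rightarrow> 'a \<Rightarrow> 'b \<Rightarrow> 'a \<Rightarrow> 'b \<Rightarrow> complex"
    unfolding reorder by (rule trans [OF sum.swap]) (intro sum.cong refl sum.swap)
  have sum_if: "(\<Sum>x\<in>A. if b then f x else 0) = (if b then sum f A else 0)"
    for A :: "'c set" and b and f :: "'c \<Rightarrow> complex"
    by simp
  note entries = trace_mult sum_UNIV_prod mat_def mult_delta_left mult_delta_right sum_if
    sum_distrib_left
  show "trace (tensor_op X Y ** reduction_AB \<sigma>)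
      = trace (tensor_op (tensor_op X (mat 1)) (tensor_op Y (mat 1)) ** \<sigma>)"
    by (simp add: entries reduction_AB_def reorder)
  show "trace (tensor_op X Y ** reduction_A'B' \<sigma>)
      = trace (tensor_op (tensor_op (mat 1) X) (tensor_op (mat 1) Y) ** \<sigma>)"
    by (simp add: entries reduction_A'B'_def reorder')
qed

subsection \<open>The two implications\<close>

lemma channel_psd: "psd (\<Theta> X)" if "channel \<Theta>" "psd X"
proof -
  \<comment> \<open>Complete positivity with a single block is positivity.\<close>
  have "block_psd 1 (\<lambda>i j. X)"
    using that(2) by (simp add: block_psd_def psd_def)
  then have "block_psd 1 (\<lambda>i j. \<Theta> X)"
    using that(1) unfolding channel_def completely_positive_def by blast
  then have "cinner v (\<Theta> X *v v) \<in> \<real>\<^sub>\<ge>\<^sub>0" for v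
    unfolding block_psd_def by (drule_tac spec [of _ "\<lambda>_. v"]) simp
  then show ?thesis
    by (simp add: psd_def)
qed

text \<open>By duality, positivity of \<open>\<Theta>\<close> gives positivity on product effects,
  and trace preservation gives unitality.\<close>

lemma channel_joint:
  fixes \<Theta> :: "'a::finite operator \<Rightarrow> ('a \<times> 'a) operator"
  assumes "channel \<Theta>"
  shows "joint (\<lambda>P Q. heisenberg \<Theta> (tensor_op P Q))"
proof -
  have lin: "Vector_Spaces.linear scale_op scale_op \<Theta>" and tp: "\<And>X. trace (\<Theta> X) = trace X"
    using assms by (simp_all add: channel_def trace_preserving_def)
  have "linear (heisenberg \<Theta>)"
    by (rule linearI) (simp_all add: vec_eq_iff heisenberg_def matrix_add_rdistrib matrix_mult_scaleR trace_simps)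
  then have "bilinear (\<lambda>P Q. heisenberg \<Theta> (tensor_op P Q))"
    by (simp add: bilinear_def linear_iff tensor_op_simps)
  moreover have "heisenberg \<Theta> (scale_op c P) = scale_op c (heisenberg \<Theta> P)" for c P
    by (simp add: vec_eq_iff heisenberg_def matrix_mult_scale_op trace_scale_op)
  moreover have "psd (heisenberg \<Theta> (tensor_op P Q))" if "psd P" "psd Q" for P Q
    unfolding psd_def cinner_eq_trace trace_mul_sym [of "ketbra _ _"] trace_heisenberg [OF lin]
    using that by (intro allI trace_psd_mult(1) psd_tensor_op channel_psd [OF assms] psd_ketbra)
  moreover have "heisenberg \<Theta> (mat 1) $ j $ i = axis i 1 $ j" for i j
    by (simp add: heisenberg_def tp trace_ketbra cinner_axis)
  then have "heisenberg \<Theta> (mat 1) = mat 1"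
    by (simp add: vec_eq_iff mat_def axis_def)
  ultimately show ?thesis
    by (simp add: joint_def tensor_op_simps tensor_op_mat1)
qed

section \<open>From local broadcasting to a product eigenbasis\<close>

lemma onb_tensor:
  fixes E :: "(complex ^ 'a::finite) set" and F :: "(complex ^ 'b::finite) set"
  assumes "onb E" "onb F"
  shows "onb ((\<lambda>(u, v). tensor_vec u v) ` (E \<times> F))"
  unfolding onb_def
proof (intro conjI allI impI)
  show "finite ((\<lambda>(u, v). tensor_vec u v) ` (E \<times> F))"
    using assms by (simp add: onb_def)
  \<comment> \<open>Since \<open>orthonormal\<close> decides by equality of vectors, distinct pairs
    must give distinct product vectors.\<close>
  have "tensor_vec u v = tensor_vec u' v' \<longleftrightarrow> u = u' \<and> v = v'"
    if uv: "u \<in> E" "v \<in> F" "u' \<in> E" "v' \<in> F" for u v u' v'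
  proof
    assume eq: "tensor_vec u v = tensor_vec u' v'"
    have "cinner u u' * cinner v v' = cinner u' u' * cinner v' v'"
      by (metis eq cinner_tensor_vec)
    then show "u = u' \<and> v = v'"
      using assms uv by (auto simp: onb_def orthonormal_def split: if_splits)
  qed simp
  then show "orthonormal ((\<lambda>(u, v). tensor_vec u v) ` (E \<times> F))"
    using assms by (auto simp: orthonormal_def onb_def cinner_tensor_vec)
  fix w :: "complex ^ ('a \<times> 'b)"
  assume w: "\<forall>x\<in>(\<lambda>(u, v). tensor_vec u v) ` (E \<times> F). cinner x w = 0"
  \<comment> \<open>Contracting \<open>w\<close> with \<open>v\<close> leaves a vector orthogonal to
    \<open>E\<close>; afterwards each slice of \<open>w\<close> is orthogonal to
    \<open>F\<close>.\<close>
  have partial0: "(\<chi> i. \<Sum>k\<in>UNIV. cnj (v $ k) * w $ (i, k)) = 0" if "v \<in> F" for v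
  proof -
    have "cinner u (\<chi> i. \<Sum>k\<in>UNIV. cnj (v $ k) * w $ (i, k)) = cinner (tensor_vec u v) w" for u
      by (simp add: cinner_def tensor_vec_def sum_UNIV_prod sum_distrib_left mult_ac)
    then show ?thesis
      using w that by (intro onb_vec_eqI [OF assms(1)]) auto
  qed
  have "(\<chi> k. w $ (i, k)) = 0" for i
  proof (rule onb_vec_eqI [OF assms(2)])
    fix v assume "v \<in> F"
    from partial0 [OF this] show "cinner v (\<chi> k. w $ (i, k)) = cinner v 0"
      by (simp add: vec_eq_iff cinner_def)
  qed
  then show "w = 0"
    by (simp add: vec_eq_iff)
qed

text \<open>The common eigenbasis comes from Hermitian \<open>Y\<close>; the Cartesian decomposition
  extends the vanishing of off-diagonal entries to every \<open>Y\<close>, in particular to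
  \<open>ketbra v v'\<close>, where it will be applied.\<close>

lemma steering_diagonal:
  fixes T :: "'b::finite operator \<Rightarrow> 'a::finite operator"
  assumes comm: "\<And>Y Y'. \<lbrakk>hermitian Y; hermitian Y'\<rbrakk> \<Longrightarrow> T Y ** T Y' = T Y' ** T Y"
    and herm: "\<And>Y. hermitian Y \<Longrightarrow> hermitian (T Y)"
    and lin: "\<And>Y Y'. T (Y + Y') = T Y + T Y'" "\<And>Y. T (scale_op \<i> Y) = scale_op \<i> (T Y)"
  shows "\<exists>B. onb B \<and> (\<forall>Y. \<forall>u\<in>B. \<forall>u'\<in>B. u \<noteq> u' \<longrightarrow> cinner u' (T Y *v u) = 0)"
proof -
  have "\<exists>B. onb B \<and> (\<forall>X\<in>T ` {Y. hermitian Y}. \<forall>u\<in>B. \<exists>r::real. X *v u = r *\<^sub>R u)"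
    using comm herm by (intro commuting_common_eigenbasis) auto
  then obtain B where B: "onb B"
    and eig: "\<And>Y u. \<lbrakk>hermitian Y; u \<in> B\<rbrakk> \<Longrightarrow> \<exists>r::real. T Y *v u = r *\<^sub>R u"
    by blast
  have "cinner u' (T Y *v u) = 0" if u: "u \<in> B" "u' \<in> B" "u \<noteq> u'" for u u' Y
  proof -
    have *: "cinner u' (T H *v u) = 0" if H: "hermitian H" for H
    proof -
      obtain r :: real where "T H *v u = r *\<^sub>R u"
        using eig [OF H u(1)] by blast
      then show ?thesis
        using B u by (simp add: cinner_scaleR_right onb_def orthonormal_def)
    qed
    have scale: "scale_op \<i> X *v u = \<i> *s (X *v u)" for X :: "'a operator"
      by (simp add: vec_eq_iff matrix_vector_mult_def sum_distrib_left mult_ac)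
    show ?thesis
      using * cartesian_decomposition [of Y]
      by (metis (no_types, lifting) lin scale add_0 matrix_vector_mult_add_rdistrib cinner_add_right
          cinner_scale_right mult_zero_right)
  qed
  with B show ?thesis
    by blast
qed

lemma locally_broadcastable_imp_classical_classical:
  fixes \<rho> :: "('a::finite \<times> 'b::finite) operator"
  assumes "is_state \<rho>" "locally_broadcastable \<rho>"
  shows "classical_classical \<rho>"
proof -
  have \<rho>: "psd \<rho>" "trace \<rho> = 1"
    using assms(1) by (simp_all add: is_state_def)
  obtain \<Theta>A :: "'a operator \<Rightarrow> ('a \<times> 'a) operator" and \<Theta>B :: "'b operator \<Rightarrow> ('b \<times> 'b) operator"
    where ch: "channel \<Theta>A" "channel \<Theta>B"
      and red: "reduction_AB (tensor_map \<Theta>A \<Theta>B \<rho>) = \<rho>" "reduction_A'B' (tensor_map \<Theta>A \<Theta>B \<rho>) = \<rho>"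
    using assms(2) by (auto simp: locally_broadcastable_def broadcast_state_def)
  define \<alpha> where "\<alpha> P Q = heisenberg \<Theta>A (tensor_op P Q)" for P Q
  define \<beta> where "\<beta> P Q = heisenberg \<Theta>B (tensor_op P Q)" for P Q
  have joint: "joint \<alpha>" "joint \<beta>"
    using ch [THEN channel_joint] by (simp_all add: \<alpha>_def [abs_def] \<beta>_def [abs_def])
  \<comment> \<open>The two broadcasting conditions, read in the Heisenberg picture.\<close>
  have inv: "trace (tensor_op (\<alpha> X (mat 1)) (\<beta> Y (mat 1)) ** \<rho>) = trace (tensor_op X Y ** \<rho>)"
    "trace (tensor_op (\<alpha> (mat 1) X) (\<beta> (mat 1) Y) ** \<rho>) = trace (tensor_op X Y ** \<rho>)" for X Y
    unfolding \<alpha>_def \<beta>_def trace_tensor_map [symmetric] trace_reduction [symmetric] red by simp_all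
  have linA: "linear (steer_A \<rho>)" and linB: "linear (steer_B \<rho>)"
    by (simp_all add: linear_iff steer_simps)
  have comm_A: "steer_A \<rho> Y ** steer_A \<rho> Y' = steer_A \<rho> Y' ** steer_A \<rho> Y" if "hermitian Y" "hermitian Y'" for Y Y'
    using joint linA psd_steer(1) [OF \<rho>(1)] _ _ that by (rule steered_commute) (simp_all add: trace_steer inv)
  have comm_B: "steer_B \<rho> X ** steer_B \<rho> X' = steer_B \<rho> X' ** steer_B \<rho> X" if "hermitian X" "hermitian X'" for X X'
    using joint(2,1) linB psd_steer(2) [OF \<rho>(1)] _ _ that by (rule steered_commute) (simp_all add: trace_steer inv)
  from steering_diagonal [OF comm_A positive_map_hermitian [OF linA psd_steer(1) [OF \<rho>(1)]] steer_simps(1,3)]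
  obtain E where E: "onb E" "\<And>u u' Y. \<lbrakk>u \<in> E; u' \<in> E; u \<noteq> u'\<rbrakk> \<Longrightarrow> cinner u' (steer_A \<rho> Y *v u) = 0"
    by blast
  from steering_diagonal [OF comm_B positive_map_hermitian [OF linB psd_steer(2) [OF \<rho>(1)]] steer_simps(4,6)]
  obtain F where F: "onb F" "\<And>v v' X. \<lbrakk>v \<in> F; v' \<in> F; v \<noteq> v'\<rbrakk> \<Longrightarrow> cinner v' (steer_B \<rho> X *v v) = 0"
    by blast
  have fin: "finite E" "finite F" and orth: "orthonormal E" "orthonormal F"
    using E(1) F(1) by (simp_all add: onb_def)
  define p where "p u v = tensor_vec u v \<bullet> (\<rho> *v tensor_vec u v)" for u v
  have p0: "0 \<le> p u v" for u v
    using psd_inner [OF \<rho>(1)] by (simp add: p_def)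
  \<comment> \<open>The entry of \<open>\<rho>\<close> between two product vectors is the entry
    between \<open>u'\<close> and \<open>u\<close> of the operator of A steered by
    \<open>ketbra v v'\<close>, so it vanishes for \<open>u \<noteq> u'\<close>; steering from A
    instead covers \<open>v \<noteq> v'\<close>.\<close>
  have elem: "cinner (tensor_vec u' v') (\<rho> *v tensor_vec u v)
      = (if u' = u \<and> v' = v then of_real (p u v) else 0)"
    if uv: "u \<in> E" "v \<in> F" "u' \<in> E" "v' \<in> F" for u v u' v'
  proof -
    have tr: "cinner (tensor_vec u' v') (\<rho> *v tensor_vec u v)
        = trace (tensor_op (ketbra u u') (ketbra v v') ** \<rho>)"
      by (simp add: tensor_op_ketbra trace_mult_ketbra trace_mul_sym [of "ketbra _ _"])
    have "trace (tensor_op (ketbra u u') (ketbra v v') ** \<rho>) = 0" if "u \<noteq> u'"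
      unfolding trace_steer(1) [symmetric] trace_mul_sym [of "ketbra u u'"] trace_mult_ketbra
      using E(2) uv that by blast
    moreover have "trace (tensor_op (ketbra u u') (ketbra v v') ** \<rho>) = 0" if "v \<noteq> v'"
      unfolding trace_steer(2) [symmetric] trace_mul_sym [of "ketbra v v'"] trace_mult_ketbra
      using F(2) uv that by blast
    moreover have "cinner (tensor_vec u v) (\<rho> *v tensor_vec u v) = of_real (p u v)"
      using \<rho>(1) by (simp add: psd_def p_def complex_nonneg_Reals_iff complex_eq_iff inner_eq_Re_cinner)
    ultimately show ?thesis
      using tr by auto
  qed
  let ?B = "(\<lambda>(u, v). tensor_vec u v) ` (E \<times> F)"
  have B: "onb ?B"
    by (rule onb_tensor [OF E(1) F(1)])
  have "\<rho> = (\<Sum>u\<in>E. \<Sum>v\<in>F. p u v *\<^sub>R tensor_op (ketbra u u) (ketbra v v))"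
  proof (rule onb_operator_eqI [OF B], rule onb_vec_eqI [OF B])
    fix x y assume "x \<in> ?B" "y \<in> ?B"
    then obtain u v u' v' where x: "x = tensor_vec u v" and y: "y = tensor_vec u' v'"
      and uv: "u \<in> E" "v \<in> F" "u' \<in> E" "v' \<in> F"
      by auto
    have "cinner y ((\<Sum>a\<in>E. \<Sum>b\<in>F. p a b *\<^sub>R tensor_op (ketbra a a) (ketbra b b)) *v x)
        = (\<Sum>a\<in>E. \<Sum>b\<in>F. p a b *\<^sub>R (cinner u' a * cinner v' b * (cinner a u * cinner b v)))"
      by (simp add: sum_matrix_vector_mult cinner_sum_right matrix_vector_scaleR cinner_scaleR_right
          tensor_op_ketbra cinner_ketbra cinner_tensor_vec x y)
    also have "\<dots> = (\<Sum>a\<in>E. \<Sum>b\<in>F. if a = u \<and> b = v then (if u' = u \<and> v' = v then of_real (p u v) else 0) else 0)"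
      using orth uv by (intro sum.cong refl) (auto simp: orthonormal_def scaleR_conv_of_real [where 'a = complex])
    also have "\<dots> = (\<Sum>a\<in>E. if a = u then (if u' = u \<and> v' = v then of_real (p u v) else 0) else 0)"
      using fin uv by (intro sum.cong refl) auto
    also have "\<dots> = cinner y (\<rho> *v x)"
      using fin uv by (simp add: elem x y)
    finally show "cinner y (\<rho> *v x) = cinner y ((\<Sum>a\<in>E. \<Sum>b\<in>F. p a b *\<^sub>R tensor_op (ketbra a a) (ketbra b b)) *v x)"
      by simp
  qed
  moreover from this have "(\<Sum>u\<in>E. \<Sum>v\<in>F. p u v) = 1"
  proof -
    assume eq: "\<rho> = (\<Sum>u\<in>E. \<Sum>v\<in>F. p u v *\<^sub>R tensor_op (ketbra u u) (ketbra v v))"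
    have "trace \<rho> = (\<Sum>u\<in>E. \<Sum>v\<in>F. of_real (p u v))"
      using orth by (subst eq) (simp add: trace_sum trace_simps trace_tensor_op trace_ketbra
          orthonormal_def scaleR_conv_of_real [where 'a = complex])
    also have "\<dots> = of_real (\<Sum>u\<in>E. \<Sum>v\<in>F. p u v)"
      by simp
    finally show ?thesis
      using \<rho>(2) by (metis of_real_eq_1_iff)
  qed
  ultimately show ?thesis
    unfolding classical_classical_def using fin orth p0 by blast
qed

section \<open>Broadcasting a classical-classical state\<close>

definition measure_prepare :: "(complex ^ 'a::finite) set \<Rightarrow> 'a operator \<Rightarrow> ('a \<times> 'a) operator"
  where "measure_prepare E X = (\<Sum>u\<in>E. scale_op (cinner u (X *v u)) (tensor_op (ketbra u u) (ketbra u u)))"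

lemma measure_prepare_ketbra:
  "measure_prepare E (ketbra u u) = tensor_op (ketbra u u) (ketbra u u)" if "onb E" "u \<in> E"
  for E :: "(complex ^ 'a::finite) set"
proof -
  have "scale_op 1 X = X" "scale_op 0 X = 0" for X :: "('a \<times> 'a) operator"
    by (simp_all add: vec_eq_iff)
  then have "measure_prepare E (ketbra u u) = (\<Sum>w\<in>E. if w = u then tensor_op (ketbra u u) (ketbra u u) else 0)"
    unfolding measure_prepare_def using that
    by (intro sum.cong refl) (simp add: cinner_ketbra onb_def orthonormal_def)
  then show ?thesis
    using that by (simp add: onb_def)
qed

lemma channel_measure_prepare:
  assumes "onb E"
  shows "channel (measure_prepare E)"
  unfolding channel_def
proof (intro conjI)
  have scale_vec: "scale_op c X *v v = c *s (X *v v)" for c and X :: "'c::finite operator" and v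
    by (simp add: vec_eq_iff matrix_vector_mult_def sum_distrib_left mult_ac)
  have "scale_op (c + d) X = scale_op c X + scale_op d X" "scale_op c (scale_op d X) = scale_op (c * d) X"
    "scale_op c (X + Y) = scale_op c X + scale_op c Y" "scale_op c 0 = 0" for c d and X Y :: "'c::finite operator"
    by (simp_all add: vec_eq_iff algebra_simps)
  note scale = this
  have scale_sum: "scale_op c (sum f A) = (\<Sum>x\<in>A. scale_op c (f x))"
    for c A and f :: "'d \<Rightarrow> 'c::finite operator"
    by (induction A rule: infinite_finite_induct) (simp_all add: scale)
  show "Vector_Spaces.linear scale_op scale_op (measure_prepare E)"
    by (simp add: Vector_Spaces.linear_iff vector_space_scale_op measure_prepare_def
        matrix_vector_mult_add_rdistrib cinner_add_right scale sum.distrib scale_sum scale_vec cinner_scale_right)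
  show "completely_positive (measure_prepare E)"
    unfolding completely_positive_def
  proof (intro allI impI)
    fix n and X :: "nat \<Rightarrow> nat \<Rightarrow> 'a operator"
    assume X: "block_psd n X"
    show "block_psd n (\<lambda>i j. measure_prepare E (X i j))"
      unfolding block_psd_def
    proof
      fix v :: "nat \<Rightarrow> complex ^ ('a \<times> 'a)"
      \<comment> \<open>The prepared states have rank one, so testing the output on \<open>v\<close>
        means testing the input blocks, for each \<open>u\<close>, on multiples of \<open>u\<close>
        with these coefficients.\<close>
      let ?c = "\<lambda>u i. cinner (tensor_vec u u) (v i) *s u"
      have "(\<Sum>i<n. \<Sum>j<n. cinner (v i) (measure_prepare E (X i j) *v v j))
          = (\<Sum>i<n. \<Sum>j<n. \<Sum>u\<in>E. cinner (?c u i) (X i j *v ?c u j))"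
        by (simp add: measure_prepare_def sum_matrix_vector_mult cinner_sum_right scale_vec
            tensor_op_ketbra cinner_scale_right cinner_scale_left cinner_ketbra cnj_cinner
            matrix_vector_mult_cscale mult_ac)
      also have "\<dots> = (\<Sum>i<n. \<Sum>u\<in>E. \<Sum>j<n. cinner (?c u i) (X i j *v ?c u j))"
        by (intro sum.cong refl sum.swap)
      also have "\<dots> = (\<Sum>u\<in>E. \<Sum>i<n. \<Sum>j<n. cinner (?c u i) (X i j *v ?c u j))"
        by (rule sum.swap)
      also have "\<dots> \<in> \<real>\<^sub>\<ge>\<^sub>0"
        using X by (induction E rule: infinite_finite_induct) (simp_all add: block_psd_def)
      finally show "(\<Sum>i<n. \<Sum>j<n. cinner (v i) (measure_prepare E (X i j) *v v j)) \<in> \<real>\<^sub>\<ge>\<^sub>0" .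
    qed
  qed
  have "trace (measure_prepare E X) = (\<Sum>u\<in>E. cinner u (X *v u))" for X
    unfolding measure_prepare_def trace_sum using assms
    by (intro sum.cong refl)
      (simp add: trace_scale_op trace_tensor_op trace_ketbra onb_def orthonormal_def)
  then show "trace_preserving (measure_prepare E)"
    by (simp add: trace_preserving_def onb_trace [OF assms])
qed

lemma linear_reduction: "linear reduction_AB" "linear reduction_A'B'"
  by (simp_all add: linear_iff reduction_AB_def reduction_A'B'_def vec_eq_iff sum.distrib scaleR_sum_right)

lemma reduction_tensor_op:
  "reduction_AB (tensor_op (tensor_op X X') (tensor_op Y Y')) = scale_op (trace X' * trace Y') (tensor_op X Y)"
  "reduction_A'B' (tensor_op (tensor_op X X') (tensor_op Y Y')) = scale_op (trace X * trace Y) (tensor_op X' Y')"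
  by (simp_all add: vec_eq_iff reduction_AB_def reduction_A'B'_def trace_def mult.assoc
      sum_distrib_left [symmetric] sum_distrib_right [symmetric])

lemma classical_classical_imp_locally_broadcastable:
  fixes \<rho> :: "('a::finite \<times> 'b::finite) operator"
  assumes "classical_classical \<rho>"
  shows "locally_broadcastable \<rho>"
proof -
  obtain E :: "(complex ^ 'a) set" and F :: "(complex ^ 'b) set" and p :: "complex ^ 'a \<Rightarrow> complex ^ 'b \<Rightarrow> real"
    where orth: "orthonormal E" "orthonormal F"
      and p: "\<forall>u\<in>E. \<forall>v\<in>F. 0 \<le> p u v" "(\<Sum>u\<in>E. \<Sum>v\<in>F. p u v) = 1"
      and \<rho>: "\<rho> = (\<Sum>u\<in>E. \<Sum>v\<in>F. p u v *\<^sub>R tensor_op (ketbra u u) (ketbra v v))"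
    using assms unfolding classical_classical_def by blast
  \<comment> \<open>The given orthonormal sets may be incomplete; complete bases make the
    measurement trace preserving.\<close>
  obtain E' F' where E': "onb E'" "E \<subseteq> E'" and F': "onb F'" "F \<subseteq> F'"
    using orth [THEN orthonormal_extend_onb] by blast
  have ch: "channel (measure_prepare E')" "channel (measure_prepare F')"
    using E' F' by (simp_all add: channel_measure_prepare)
  interpret tm: Vector_Spaces.linear scale_op scale_op "tensor_map (measure_prepare E') (measure_prepare F')"
    by (rule linear_tensor_map)
  have R: "r *\<^sub>R X = scale_op (of_real r) X" for r and X :: "'c::finite operator"
    by (simp add: vec_eq_iff scaleR_conv_of_real [where 'a = complex])
  define \<sigma> where "\<sigma> = (\<Sum>u\<in>E. \<Sum>v\<in>F. p u v *\<^sub>R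
      tensor_op (tensor_op (ketbra u u) (ketbra u u)) (tensor_op (ketbra v v) (ketbra v v)))"
  have \<sigma>: "tensor_map (measure_prepare E') (measure_prepare F') \<rho> = \<sigma>"
    unfolding \<rho> \<sigma>_def R tm.sum tm.scale
    using ch E' F'
    by (intro sum.cong refl)
      (simp add: channel_def tensor_map_tensor_op measure_prepare_ketbra subset_iff)
  have tr: "trace (ketbra u u) = 1" "trace (ketbra v v) = 1" if "u \<in> E" "v \<in> F" for u v
    using orth that by (simp_all add: trace_ketbra orthonormal_def)
  have "psd \<sigma>"
    unfolding \<sigma>_def using p(1) by (intro psd_sum psd_scaleR psd_tensor_op psd_ketbra) auto
  moreover have "trace \<sigma> = of_real (\<Sum>u\<in>E. \<Sum>v\<in>F. p u v)"
    unfolding \<sigma>_def of_real_sum trace_sum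
    by (intro sum.cong refl) (simp add: trace_simps trace_tensor_op tr scaleR_conv_of_real [where 'a = complex])
  moreover have "reduction_AB \<sigma> = \<rho>" "reduction_A'B' \<sigma> = \<rho>"
    unfolding \<sigma>_def \<rho> linear_sum [OF linear_reduction(1)] linear_sum [OF linear_reduction(2)]
    by (intro sum.cong refl;
        simp add: linear_scale [OF linear_reduction(1)] linear_scale [OF linear_reduction(2)]
          reduction_tensor_op tr; simp add: vec_eq_iff)+
  ultimately have "broadcast_state \<sigma> \<rho>"
    by (simp add: broadcast_state_def is_state_def p(2))
  then show ?thesis
    unfolding locally_broadcastable_def \<sigma> [symmetric] using ch by blast
qed

theorem theorem3:
  fixes \<rho> :: "('a::finite \<times> 'b::finite) operator"
  assumes "is_state \<rho>"
  shows "locally_broadcastable \<rho> \<longleftrightarrow> classical_classical \<rho>"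
  using locally_broadcastable_imp_classical_classical [OF assms]
    classical_classical_imp_locally_broadcastable by blast

end
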